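(* Let $\mathcal P$ be Thoma parameters satisfying the strict monotonicity condition ($\alpha_i>\alpha_{i+1}$ whenever $\alpha_i\ne0$, and $\beta_j>\beta_{j+1}$ whenever $\beta_j\ne0$), and let $K,L>0$ be integers with $\alpha_1>\dots>\alpha_K>0$ and $\beta_1>\dots>\beta_L>0$. Let $p$ be any admissible linear order on $\mathcal A$, and on the probability space $(\mathcal A^n,\mu_n)$ define $\lambda_i^{\mathcal P}(n)(w)=\lambda_i(\phi_p(w))$, $\lambda_j'^{\mathcal P}(n)(w)=\lambda_j'(\phi_p(w))$ (lengths of the $i$-th row and $j$-th column of $\phi_p(w)$), and $\epsilon_i(n)=\lambda_i^{\mathcal P}(n)-N_{x_i}(n)$ for $i=1,\dots,K$, $\epsilon_j'(n)=\lambda_j'^{\mathcal P}(n)-N_{y_j}(n)$ for $j=1,\dots,L$. Then there is a constant $C$ (independent of $n$) such that $\mathbf E|\epsilon_i(n)|<C$ and $\mathbf E|\epsilon_j'(n)|<C$ for all $n\ge1$, $i=1,\dots,K$, $j=1,\dots,L$.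
   Context: Thoma parameters: $\mathcal P=(\{\alpha_i\}_{i\ge1},\{\beta_j\}_{j\ge1},\gamma)$ with $\alpha_1\ge\alpha_2\ge\dots\ge0$, $\beta_1\ge\beta_2\ge\dots\ge0$, $\gamma\ge0$, $\sum_i(\alpha_i+\beta_i)+\gamma=1$. Alphabet: $\mathcal A=L_e\sqcup L_o\sqcup G$ where $L_e=\{x_1,x_2,\dots\}$, $L_o=\{y_1,y_2,\dots\}$ are discrete and $G$ is identified with an interval of $\mathbb R$. $\mu_1$ is the probability measure on $\mathcal A$ with $\mu_1(\{x_i\})=\alpha_i$, $\mu_1(\{y_j\})=\beta_j$, and restriction to $G$ equal to Lebesgue measure normalized to total mass $\gamma$; $\mu_n=\mu_1^{\otimes n}$ on $\mathcal A^n$. $N_{x_i}(n)(w)$, $N_{y_j}(n)(w)$ are the numbers of occurrences of $x_i$, $y_j$ in $w\in\mathcal A^n$. An admissible order is a linear order $p$ on $\mathcal A$ for which $G$ is an interval (if $a_1<a<a_2$ with $a_1,a_2\in G$ then $a\in G$) and whose restriction to $G$ is the usual order of reals or its reverse. Generalised RSK (row insertion) w.r.t. $p$: an $\mathcal A_p$-tableau is a Young diagram filled with letters of $\mathcal A$. To insert a letter $x$ into a tableau $T$: in the first row, if $x\in L_e$ find the leftmost entry strictly greater than $x$; if $x\in L_o\cup G$ find the leftmost entry greater than or equal to $x$; if there is none, append $x$ at the end of the row and stop; otherwise $x$ replaces that entry and the replaced entry is inserted into the second row by the same rule, and so on (an entry bumped out of the last row forms a new row). For $w=z_1\cdots z_n$,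 $R(w)$ is obtained by inserting $z_1,z_2,\dots,z_n$ successively into the empty tableau, and $\phi_p(w)\in\mathbb Y_n$ is the shape of $R(w)$. (It is known that the pushforward of $\mu_n$ under $\phi_p$ is the measure $M_n^{\mathcal P}$ of the extremal character with parameters $\mathcal P$.) *)

theory Defs
  imports "HOL-Probability.Probability"
begin

text \<open>Letters: X i (i \<ge> 1) form L_e, Y j (j \<ge> 1) form L_o, G r (r in [0,1]) form G.
  Letters X 0, Y 0 and G r with r outside [0,1] are junk (measure zero, not in the alphabet).\<close>
datatype letter = X nat | Y nat | G real

definition Le_set :: "letter set" where "Le_set = {X i | i. 1 \<le> i}"
definition Lo_set :: "letter set" where "Lo_set = {Y j | j. 1 \<le> j}"
definition G_set :: "letter set" where "G_set = G ` {0..1}"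
definition Alph :: "letter set" where "Alph = Le_set \<union> Lo_set \<union> G_set"

definition thoma_params :: "(nat \<Rightarrow> real) \<Rightarrow> (nat \<Rightarrow> real) \<Rightarrow> real \<Rightarrow> bool" where
  "thoma_params \<alpha> \<beta> \<gamma> \<longleftrightarrow>
     (\<forall>i\<ge>1. \<alpha> i \<ge> \<alpha> (Suc i) \<and> \<alpha> (Suc i) \<ge> 0) \<and> \<alpha> 1 \<ge> 0 \<and>
     (\<forall>j\<ge>1. \<beta> j \<ge> \<beta> (Suc j) \<and> \<beta> (Suc j) \<ge> 0) \<and> \<beta> 1 \<ge> 0 \<and>
     \<gamma> \<ge> 0 \<and>
     summable (\<lambda>i. \<alpha> (Suc i) + \<beta> (Suc i)) \<and>
     (\<Sum>i. \<alpha> (Suc i) + \<beta> (Suc i)) + \<gamma> = 1"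

definition strictly_monotone_params :: "(nat \<Rightarrow> real) \<Rightarrow> (nat \<Rightarrow> real) \<Rightarrow> bool" where
  "strictly_monotone_params \<alpha> \<beta> \<longleftrightarrow>
     (\<forall>i\<ge>1. \<alpha> i \<noteq> 0 \<longrightarrow> \<alpha> i > \<alpha> (Suc i)) \<and>
     (\<forall>j\<ge>1. \<beta> j \<noteq> 0 \<longrightarrow> \<beta> j > \<beta> (Suc j))"

definition letter_sets :: "letter set set" where
  "letter_sets = {A. {r. G r \<in> A} \<in> sets borel}"

definition mu1 :: "(nat \<Rightarrow> real) \<Rightarrow> (nat \<Rightarrow> real) \<Rightarrow> real \<Rightarrow> letter measure" where
  "mu1 \<alpha> \<beta> \<gamma> = measure_of UNIV letter_sets
     (\<lambda>A. (\<Sum>i. ennreal (\<alpha> (Suc i)) * indicator A (X (Suc i)))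
         + (\<Sum>j. ennreal (\<beta> (Suc j)) * indicator A (Y (Suc j)))
         + ennreal \<gamma> * emeasure lborel ({0..1} \<inter> {r. G r \<in> A}))"

text \<open>mu_n: the n-fold product; a word z_1...z_n is a function w on {0..<n}, z_k = w (k-1).\<close>
definition mun :: "(nat \<Rightarrow> real) \<Rightarrow> (nat \<Rightarrow> real) \<Rightarrow> real \<Rightarrow> nat \<Rightarrow> (nat \<Rightarrow> letter) measure" where
  "mun \<alpha> \<beta> \<gamma> n = PiM {..<n} (\<lambda>_. mu1 \<alpha> \<beta> \<gamma>)"

definition word :: "nat \<Rightarrow> (nat \<Rightarrow> letter) \<Rightarrow> letter list" where
  "word n w = map w [0..<n]"

definition count_letter :: "letter \<Rightarrow> nat \<Rightarrow> (nat \<Rightarrow> letter) \<Rightarrow> nat" where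
  "count_letter a n w = length (filter (\<lambda>z. z = a) (word n w))"

text \<open>A linear order p on the alphabet, given as a relation (a,b) \<in> p meaning a \<le> b.\<close>
definition admissible :: "letter rel \<Rightarrow> bool" where
  "admissible p \<longleftrightarrow> linear_order_on Alph p \<and>
     (\<forall>a1 a2 a. a1 \<in> G_set \<longrightarrow> a2 \<in> G_set \<longrightarrow> a \<in> Alph \<longrightarrow>
        (a1, a) \<in> p \<longrightarrow> a1 \<noteq> a \<longrightarrow> (a, a2) \<in> p \<longrightarrow> a \<noteq> a2 \<longrightarrow> a \<in> G_set) \<and>
     ((\<forall>r\<in>{0..1}. \<forall>s\<in>{0..1}. (G r, G s) \<in> p \<longleftrightarrow> r \<le> s) \<or>
      (\<forall>r\<in>{0..1}. \<forall>s\<in>{0..1}. (G r, G s) \<in> p \<longleftrightarrow> s \<le> r))"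

definition bumps :: "letter rel \<Rightarrow> letter \<Rightarrow> letter \<Rightarrow> bool" where
  "bumps p x y = (if x \<in> Le_set then (x, y) \<in> p \<and> x \<noteq> y else (x, y) \<in> p)"

fun row_insert :: "letter rel \<Rightarrow> letter list \<Rightarrow> letter \<Rightarrow> letter list \<times> letter option" where
  "row_insert p [] x = ([x], None)"
| "row_insert p (y # ys) x =
     (if bumps p x y then (x # ys, Some y)
      else (let (r, b) = row_insert p ys x in (y # r, b)))"

fun tab_insert :: "letter rel \<Rightarrow> letter list list \<Rightarrow> letter \<Rightarrow> letter list list" where
  "tab_insert p [] x = [[x]]"
| "tab_insert p (r # rs) x =
     (case row_insert p r x of
        (r', None) \<Rightarrow> r' # rs
      | (r', Some y) \<Rightarrow> r' # tab_insert p rs y)"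

definition RSK :: "letter rel \<Rightarrow> letter list \<Rightarrow> letter list list" where
  "RSK p ws = foldl (tab_insert p) [] ws"

definition phi :: "letter rel \<Rightarrow> letter list \<Rightarrow> nat list" where
  "phi p ws = map length (RSK p ws)"

definition row_len :: "nat list \<Rightarrow> nat \<Rightarrow> nat" where
  "row_len lam i = (if 1 \<le> i \<and> i \<le> length lam then lam ! (i - 1) else 0)"

definition col_len :: "nat list \<Rightarrow> nat \<Rightarrow> nat" where
  "col_len lam j = length (filter (\<lambda>l. j \<le> l) lam)"

definition eps :: "letter rel \<Rightarrow> nat \<Rightarrow> nat \<Rightarrow> (nat \<Rightarrow> letter) \<Rightarrow> int" where
  "eps p n i w = int (row_len (phi p (word n w)) i) - int (count_letter (X i) n w)"

definition eps' :: "letter rel \<Rightarrow> nat \<Rightarrow> nat \<Rightarrow> (nat \<Rightarrow> letter) \<Rightarrow> int" where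
  "eps' p n j w = int (col_len (phi p (word n w)) j) - int (count_letter (Y j) n w)"

end

theory Submission
  imports Defs "HOL-Real_Asymp.Real_Asymp"
begin

text \<open>Standardising the word turns the generalised insertion into ordinary row insertion of a
  permutation, so by Greene's theorem the first \<open>k\<close> rows of the shape have as many cells as \<open>k\<close> disjoint
  increasing subsequences can cover (for columns: decreasing subsequences). The occurrences of
  \<open>x\<^sub>1, \<dots>, x\<^sub>k\<close> are such subsequences, hence \<open>S\<^sub>k = \<epsilon>\<^sub>1 + \<dots> + \<epsilon>\<^sub>k\<close> is nonnegative, and it remains to
  bound the mean of \<open>S\<^sub>k\<close>, because \<open>\<bar>\<epsilon>\<^sub>k\<bar> \<le> S\<^sub>k + S\<^sub>k\<^sub>-\<^sub>1\<close>.

  Cut the ordered alphabet into finitely many pieces such that \<open>x\<^sub>1, \<dots>, x\<^sub>k\<close> are pieces and every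
  other piece is lighter than \<open>x\<^sub>k\<close>, or else a letter \<open>y\<^sub>j\<close>, which a chain uses at most once.
  Each of the \<open>k\<close> chains moves monotonically through the pieces, so the chains sit on all of
  \<open>x\<^sub>1, \<dots>, x\<^sub>k\<close> during a single time interval \<open>[s, e)\<close>, in which they gain nothing over the
  occurrences of these letters. During \<open>[0, s)\<close> and \<open>[e, n)\<close> they collect letters at a rate smaller by
  some \<open>\<delta> > 0\<close>; for an interval of length \<open>l\<close> there are polynomially many possible histories, and
  each of them produces an excess whose exponential moment is at most \<open>(1 - \<delta>\<^sup>2 / 4)^l\<close>.
  Summation over \<open>s\<close> and \<open>e\<close> gives a bound that does not depend on \<open>n\<close>.\<close>

section \<open>Knuth equivalence and Greene's theorem\<close>

text \<open>Colours below \<open>k\<close> are the chains and every other colour marks an uncovered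
  entry, so disjointness is built in. The largest element is Greene's invariant; since
  \<open>f\<close> colours values and not positions, this reading requires a list without
  repetitions.\<close>

definition chain_sizes :: "('a \<Rightarrow> 'a \<Rightarrow> bool) \<Rightarrow> nat \<Rightarrow> 'a list \<Rightarrow> nat set" where
  "chain_sizes R k u =
     {length (filter (\<lambda>x. f x < k) u) | f :: 'a \<Rightarrow> nat. \<forall>c<k. sorted_wrt R (filter (\<lambda>x. f x = c) u)}"

definition strict_linear :: "('a \<Rightarrow> 'a \<Rightarrow> bool) \<Rightarrow> bool" where
  "strict_linear R \<longleftrightarrow> irreflp R \<and> transp R \<and> totalp R"

lemma strict_linear_conversep: "strict_linear R \<Longrightarrow> strict_linear R\<inverse>\<inverse>"
  unfolding strict_linear_def by simp

inductive knuth :: "('a \<Rightarrow> 'a \<Rightarrow> bool) \<Rightarrow> 'a list \<Rightarrow> 'a list \<Rightarrow> bool" for R where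
  refl: "knuth R u u"
| sym: "knuth R u v \<Longrightarrow> knuth R v u"
| trans: "knuth R u v \<Longrightarrow> knuth R v w \<Longrightarrow> knuth R u w"
| acb: "R a b \<Longrightarrow> R b c \<Longrightarrow> knuth R (u @ [a, c, b] @ v) (u @ [c, a, b] @ v)"
| bac: "R a b \<Longrightarrow> R b c \<Longrightarrow> knuth R (u @ [b, a, c] @ v) (u @ [b, c, a] @ v)"

lemma knuth_append: "knuth R u v \<Longrightarrow> knuth R (l @ u @ r) (l @ v @ r)"
proof (induction rule: knuth.induct)
  case (acb a b c u v)
  then show ?case using knuth.acb[of R a b c "l @ u" "v @ r"] by simp
next
  case (bac a b c u v)
  then show ?case using knuth.bac[of R a b c "l @ u" "v @ r"] by simp
qed (auto intro: knuth.intros)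

lemma knuth_appendL: "knuth R u v \<Longrightarrow> knuth R (l @ u) (l @ v)"
  using knuth_append[of R u v l "[]"] by simp

lemma knuth_appendR: "knuth R u v \<Longrightarrow> knuth R (u @ r) (v @ r)"
  using knuth_append[of R u v "[]" r] by simp

lemma knuth_mset: "knuth R u v \<Longrightarrow> mset u = mset v"
  by (induction rule: knuth.induct) auto

lemma knuth_distinct: "knuth R u v \<Longrightarrow> distinct u \<longleftrightarrow> distinct v"
  using knuth_mset mset_eq_imp_distinct_iff by blast

text \<open>Reversing the order exchanges the roles of \<open>a\<close> and \<open>c\<close>, which
  turns each elementary relation into itself with its two sides exchanged. Decreasing chains can
  thus be treated as chains for the converse order.\<close>

lemma knuth_conversep: "knuth R u v \<Longrightarrow> knuth R\<inverse>\<inverse> u v"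
proof (induction rule: knuth.induct)
  case (acb a b c u v)
  show ?case by (rule knuth.sym, rule knuth.acb) (use acb in auto)
next
  case (bac a b c u v)
  show ?case by (rule knuth.sym, rule knuth.bac) (use bac in auto)
qed (auto intro: knuth.intros)

lemma chain_sizes_I:
  assumes "\<And>c. c < k \<Longrightarrow> sorted_wrt R (filter (\<lambda>x. f x = c) u)"
    and "m = length (filter (\<lambda>x. f x < k) u)"
  shows "m \<in> chain_sizes R k u"
  using assms unfolding chain_sizes_def by auto

text \<open>In the word with \<open>c\<close> in front of \<open>a\<close> these two letters form a
  descent, so no chain contains both of them. Exchanging the two neighbours therefore leaves every
  chain unchanged as a word.\<close>

lemma chain_sizes_acb_easy:
  assumes "strict_linear R" "R a b" "R b c"
  shows "chain_sizes R k (u @ [c, a, b] @ v) \<subseteq> chain_sizes R k (u @ [a, c, b] @ v)"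
proof
  fix m assume "m \<in> chain_sizes R k (u @ [c, a, b] @ v)"
  then obtain f where f: "\<And>d. d < k \<Longrightarrow> sorted_wrt R (filter (\<lambda>x. f x = d) (u @ [c, a, b] @ v))"
    and m: "m = length (filter (\<lambda>x. f x < k) (u @ [c, a, b] @ v))"
    unfolding chain_sizes_def by blast
  have ac: "R a c" "\<not> R c a" using assms unfolding strict_linear_def
    by (meson transpD irreflpD)+
  show "m \<in> chain_sizes R k (u @ [a, c, b] @ v)"
  proof (rule chain_sizes_I[where f = f])
    fix d assume "d < k"
    from f[OF this] ac show "sorted_wrt R (filter (\<lambda>x. f x = d) (u @ [a, c, b] @ v))"
      by (auto simp: sorted_wrt_append split: if_splits)
  qed (use m in auto)
qed

text \<open>If one chain contains \<open>a\<close> and \<open>c\<close>, it continues through \<open>b\<close> instead of \<open>c\<close>; when \<open>b\<close>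
  already belongs to another chain, the two chains exchange their tails.\<close>

lemma chain_sizes_acb_hard:
  assumes R: "strict_linear R" "R a b" "R b c" and dist: "distinct (u @ [a, c, b] @ v)"
  shows "chain_sizes R k (u @ [a, c, b] @ v) \<subseteq> chain_sizes R k (u @ [c, a, b] @ v)"
proof
  fix m assume "m \<in> chain_sizes R k (u @ [a, c, b] @ v)"
  then obtain f where f: "\<And>d. d < k \<Longrightarrow> sorted_wrt R (filter (\<lambda>x. f x = d) (u @ [a, c, b] @ v))"
    and m: "m = length (filter (\<lambda>x. f x < k) (u @ [a, c, b] @ v))"
    unfolding chain_sizes_def by blast
  have tr: "\<And>x y z. R x y \<Longrightarrow> R y z \<Longrightarrow> R x z" and ir: "\<And>x. \<not> R x x"
    using R(1) unfolding strict_linear_def by (meson transpD irreflpD)+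
  have ac: "R a c" "\<not> R c a" "\<not> R c b" using R(2,3) tr ir by blast+
  show "m \<in> chain_sizes R k (u @ [c, a, b] @ v)"
  proof (cases "f a = f c \<and> f a < k")
    case False
    show ?thesis
    proof (rule chain_sizes_I[where f = f])
      fix d assume "d < k"
      from f[OF this] False \<open>d < k\<close> show "sorted_wrt R (filter (\<lambda>x. f x = d) (u @ [c, a, b] @ v))"
        by (auto simp: sorted_wrt_append split: if_splits)
    qed (use m in auto)
  next
    case True
    define e where "e = f a"
    have fac: "f a = e" "f c = e" "e < k" using True e_def by auto
    have fb: "f b \<noteq> e"
      using f[OF fac(3)] fac ac by (auto simp: sorted_wrt_append)
    have se: "sorted_wrt R (filter (\<lambda>x. f x = e) u)" "sorted_wrt R (filter (\<lambda>x. f x = e) v)"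
      "\<And>x. x \<in> set u \<Longrightarrow> f x = e \<Longrightarrow> R x a" "\<And>x. x \<in> set v \<Longrightarrow> f x = e \<Longrightarrow> R c x"
      using f[OF fac(3)] fac fb by (auto simp: sorted_wrt_append)
    have nin: "a \<notin> set u" "b \<notin> set u" "c \<notin> set u" "a \<notin> set v" "b \<notin> set v" "c \<notin> set v" "a \<noteq> b" "b \<noteq> c" "a \<noteq> c"
      "set u \<inter> set v = {}"
      using dist by auto
    show ?thesis
    proof (cases "f b < k")
      case False
      \<comment> \<open>Here \<open>b\<close> is uncovered: it replaces \<open>c\<close> in chain
        \<open>e\<close>, and \<open>c\<close> becomes uncovered in its place, so the number of
        covered entries stays the same.\<close>
      define g where "g = f(b := e, c := f b)"
      have gu: "filter (\<lambda>x. g x = d) u = filter (\<lambda>x. f x = d) u"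
           "filter (\<lambda>x. g x < k) u = filter (\<lambda>x. f x < k) u"
           "filter (\<lambda>x. g x = d) v = filter (\<lambda>x. f x = d) v"
           "filter (\<lambda>x. g x < k) v = filter (\<lambda>x. f x < k) v" for d
        using nin by (auto simp: g_def intro!: filter_cong)
      have g3: "g a = e" "g b = e" "g c = f b" using nin fac by (auto simp: g_def)
      show ?thesis
      proof (rule chain_sizes_I[where f = g])
        fix d assume d: "d < k"
        have "R x b" if "x \<in> set u" "f x = e" for x using se(3)[OF that] R tr by blast
        moreover have "R b x" "R a x" if "x \<in> set v" "f x = e" for x
          using se(4)[OF that] R tr ac by blast+
        ultimately show "sorted_wrt R (filter (\<lambda>x. g x = d) (u @ [c, a, b] @ v))"
          using f[OF d] False d fac R(2) se fb
          by (cases "d = e") (auto simp: sorted_wrt_append gu g3)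
      qed (use False fac m gu g3 in auto)
    next
      case True
      define h where "h = f b"
      \<comment> \<open>Chain \<open>e\<close> now consists of its part in \<open>u\<close>, then
        \<open>a\<close> and \<open>b\<close>, then the tail of \<open>h\<close>; chain
        \<open>h\<close> consists of its part in \<open>u\<close>, then \<open>c\<close>, then the
        tail of \<open>e\<close>. Both junctions are increasing because \<open>a\<close> lies below
        \<open>b\<close> and \<open>b\<close> below \<open>c\<close>.\<close>
      define g where "g = (\<lambda>x. if x \<in> set u then f x else if x = a \<or> x = b then e else if x = c then h
         else if f x = e then h else if f x = h then e else f x)"
      have fh: "f b = h" "h < k" "h \<noteq> e" using True fb h_def by auto
      have sh: "sorted_wrt R (filter (\<lambda>x. f x = h) u)" "sorted_wrt R (filter (\<lambda>x. f x = h) v)"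
        "\<And>x. x \<in> set u \<Longrightarrow> f x = h \<Longrightarrow> R x b" "\<And>x. x \<in> set v \<Longrightarrow> f x = h \<Longrightarrow> R b x"
        using f[OF fh(2)] fac fh by (auto simp: sorted_wrt_append)
      have gxu: "g x = f x" if "x \<in> set u" for x using that by (simp add: g_def)
      have gxv: "g x = (if f x = e then h else if f x = h then e else f x)" if "x \<in> set v" for x
      proof -
        have "x \<notin> set u" "x \<noteq> a" "x \<noteq> b" "x \<noteq> c" using nin that by auto
        then show ?thesis by (simp add: g_def)
      qed
      have gu: "filter (\<lambda>x. g x = d) u = filter (\<lambda>x. f x = d) u"
           "filter (\<lambda>x. g x < k) u = filter (\<lambda>x. f x < k) u" for d
        by (intro filter_cong HOL.refl; simp add: gxu)+
      have gv: "filter (\<lambda>x. g x < k) v = filter (\<lambda>x. f x < k) v"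
        using fac(3) fh(2) by (intro filter_cong HOL.refl) (simp add: gxv)
      have gve: "filter (\<lambda>x. g x = e) v = filter (\<lambda>x. f x = h) v"
        using fh(3) by (intro filter_cong HOL.refl) (auto simp add: gxv)
      have gvh: "filter (\<lambda>x. g x = h) v = filter (\<lambda>x. f x = e) v"
        using fh(3) by (intro filter_cong HOL.refl) (auto simp add: gxv)
      have gvd: "filter (\<lambda>x. g x = d) v = filter (\<lambda>x. f x = d) v" if "d \<noteq> e" "d \<noteq> h" for d
        using that by (intro filter_cong HOL.refl) (auto simp add: gxv)
      have g3: "g a = e" "g b = e" "g c = h" using nin by (simp_all add: g_def)
      show ?thesis
      proof (rule chain_sizes_I[where f = g])
        fix d assume d: "d < k"
        consider "d = e" | "d = h" | "d \<noteq> e" "d \<noteq> h" by blast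
        then show "sorted_wrt R (filter (\<lambda>x. g x = d) (u @ [c, a, b] @ v))"
        proof cases
          case 1
          have "R x y" if "x \<in> set u" "f x = e" "y \<in> set v" "f y = h" for x y
            using se(3)[OF that(1,2)] sh(4)[OF that(3,4)] R tr by blast
          moreover have "R x b" if "x \<in> set u" "f x = e" for x using se(3)[OF that] R tr by blast
          moreover have "R a x" if "x \<in> set v" "f x = h" for x
            using sh(4)[OF that] R tr by blast+
          ultimately show ?thesis unfolding 1 using fh R(2) se sh
            by (auto simp: sorted_wrt_append gu gve g3)
        next
          case 2
          have "R x y" if "x \<in> set u" "f x = h" "y \<in> set v" "f y = e" for x y
            using sh(3)[OF that(1,2)] se(4)[OF that(3,4)] R tr by blast
          moreover have "R x c" if "x \<in> set u" "f x = h" for x using sh(3)[OF that] R tr by blast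
          ultimately show ?thesis unfolding 2 using fh R(2) se sh
            by (auto simp: sorted_wrt_append gu gvh g3)
        next
          case 3
          then show ?thesis using f[OF d] fac fh
            by (auto simp: sorted_wrt_append gu gvd g3)
        qed
      qed (use fac fh m gu gv g3 in auto)
    qed
  qed
qed

lemma chain_sizes_rev: "chain_sizes R k (rev u) = chain_sizes R\<inverse>\<inverse> k u"
  unfolding chain_sizes_def
  by (simp add: rev_filter[symmetric] sorted_wrt_rev conversep_iff[abs_def])

text \<open>Only the relation \<open>acb\<close> needs an exchange argument: reversing both the word
  and the order preserves chains and carries \<open>bac\<close> to \<open>acb\<close>. Distinctness
  survives transitivity because Knuth equivalent words have the same multiset of letters.\<close>

lemma knuth_chain_sizes:
  assumes "knuth R u v" "strict_linear R" "distinct u"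
  shows "chain_sizes R k u = chain_sizes R k v"
  using assms
proof (induction rule: knuth.induct)
  case (acb a b c u v)
  then show ?case
    using chain_sizes_acb_easy[of R a b c k u v] chain_sizes_acb_hard[of R a b c u v k] by auto
next
  case (bac a b c u v)
  have s: "strict_linear R\<inverse>\<inverse>" by (rule strict_linear_conversep) fact
  have "chain_sizes R\<inverse>\<inverse> k (rev v @ [c, a, b] @ rev u) = chain_sizes R\<inverse>\<inverse> k (rev v @ [a, c, b] @ rev u)"
    using chain_sizes_acb_easy[OF s, of c b a k "rev v" "rev u"]
      chain_sizes_acb_hard[OF s, of c b a "rev v" "rev u" k] bac by auto
  then show ?case using chain_sizes_rev[of "R\<inverse>\<inverse>" k "u @ [b, a, c] @ v"] chain_sizes_rev[of "R\<inverse>\<inverse>" k "u @ [b, c, a] @ v"]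
    by simp
next
  case (trans u v w)
  then show ?case using knuth_distinct[of R u v] by simp
next
  case (sym u v)
  then show ?case using knuth_distinct[of R u v] by simp
qed simp

section \<open>Row insertion for a strict order and its Knuth moves\<close>

fun rins :: "('a \<Rightarrow> 'a \<Rightarrow> bool) \<Rightarrow> 'a list \<Rightarrow> 'a \<Rightarrow> 'a list \<times> 'a option" where
  "rins R [] x = ([x], None)"
| "rins R (y # ys) x =
     (if R x y then (x # ys, Some y) else (let (r, b) = rins R ys x in (y # r, b)))"

fun tins :: "('a \<Rightarrow> 'a \<Rightarrow> bool) \<Rightarrow> 'a list list \<Rightarrow> 'a \<Rightarrow> 'a list list" where
  "tins R [] x = [[x]]"
| "tins R (r # rs) x =
     (case rins R r x of
        (r', None) \<Rightarrow> r' # rs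
      | (r', Some y) \<Rightarrow> r' # tins R rs y)"

lemma rins_cases:
  obtains (append) "rins R r x = (r @ [x], None)" "\<And>a. a \<in> set r \<Longrightarrow> \<not> R x a"
  | (bump) A y B where "r = A @ y # B" "rins R r x = (A @ x # B, Some y)" "R x y"
      "\<And>a. a \<in> set A \<Longrightarrow> \<not> R x a"
proof -
  have "(rins R r x = (r @ [x], None) \<and> (\<forall>a\<in>set r. \<not> R x a)) \<or>
    (\<exists>A y B. r = A @ y # B \<and> rins R r x = (A @ x # B, Some y) \<and> R x y \<and> (\<forall>a\<in>set A. \<not> R x a))"
  proof (induction r)
    case (Cons z r)
    show ?case
    proof (cases "R x z")
      case True
      then show ?thesis by (intro disjI2 exI[of _ "[]"]) auto
    next
      case False
      from Cons show ?thesis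
      proof
        assume "\<exists>A y B. r = A @ y # B \<and> rins R r x = (A @ x # B, Some y) \<and> R x y \<and> (\<forall>a\<in>set A. \<not> R x a)"
        then obtain A y B where "r = A @ y # B \<and> rins R r x = (A @ x # B, Some y) \<and> R x y \<and> (\<forall>a\<in>set A. \<not> R x a)"
          by blast
        with False show ?thesis by (intro disjI2 exI[of _ "z # A"] exI[of _ y] exI[of _ B]) auto
      qed (use False in auto)
    qed
  qed auto
  then show ?thesis using that by blast
qed

text \<open>Lower rows come first, so that after an insertion into a row the bumped entry can stand
  directly behind the rows into which it is inserted next.\<close>

definition reading :: "'a list list \<Rightarrow> 'a list" where
  "reading T = concat (rev T)"

text \<open>The new entry \<open>x\<close> travels to the left through \<open>B\<close> by the
  relation \<open>bac\<close>. The witness for passing an entry \<open>b\<close> is its left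
  neighbour \<open>d\<close>, which lies strictly between \<open>x\<close> and \<open>b\<close>; for
  the first entry of \<open>B\<close> this neighbour is \<open>y\<close>.\<close>

lemma knuth_move_left:
  assumes "sorted_wrt R (y # B)" "R x y" "transp R"
  shows "knuth R (y # B @ [x]) (y # x # B)"
  using assms(1)
proof (induction B rule: rev_induct)
  case Nil
  then show ?case by (simp add: knuth.refl)
next
  case (snoc b B)
  obtain D d where D: "y # B = D @ [d]" by (metis append_butlast_last_id list.distinct(1))
  have "R d b" using snoc.prems D by (metis append_Cons append_is_Nil_conv list.set_intros(1)
     sorted_wrt_append Un_iff set_append)
  moreover have "R x d"
  proof (cases "d = y")
    case False
    then have "d \<in> set B" using D by (metis in_set_conv_decomp set_ConsD)
    then have "R y d" using snoc.prems by simp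
    then show ?thesis using assms(2,3) by (meson transpD)
  qed (use assms in simp)
  ultimately have "knuth R (D @ [d, b, x] @ []) (D @ [d, x, b] @ [])"
    by (intro knuth.sym[OF knuth.bac])
  then have "knuth R ((y # B) @ [b, x]) ((y # B) @ [x, b])" unfolding D by simp
  moreover have "knuth R ((y # B @ [x]) @ [b]) ((y # x # B) @ [b])"
    by (intro knuth_appendR snoc.IH) (use snoc.prems in \<open>auto simp: sorted_wrt_append\<close>)
  ultimately show ?case by (auto intro: knuth.trans)
qed

text \<open>The bumped entry \<open>y\<close> travels to the left through \<open>A\<close> by the
  relation \<open>acb\<close>. The witness for passing an entry is the right neighbour of
  \<open>y\<close>, which lies strictly between that entry and \<open>y\<close>.\<close>

lemma knuth_move_front:
  assumes "sorted_wrt R (A @ [x])" "R x y" "transp R"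
  shows "knuth R (A @ [y, x]) (y # A @ [x])"
  using assms(1,2)
proof (induction A arbitrary: x rule: rev_induct)
  case Nil
  then show ?case by (simp add: knuth.refl)
next
  case (snoc a A)
  have "R a x" using snoc.prems by (auto simp: sorted_wrt_append)
  then have "R a y" using snoc.prems(2) assms(3) by (meson transpD)
  have "knuth R (A @ [a, y, x] @ []) (A @ [y, a, x] @ [])"
    by (intro knuth.acb) fact+
  moreover have "knuth R ((A @ [y, a]) @ [x]) ((y # A @ [a]) @ [x])"
    by (intro knuth_appendR snoc.IH \<open>R a y\<close>) (use snoc.prems in \<open>auto simp: sorted_wrt_append\<close>)
  ultimately show ?case by (auto intro: knuth.trans)
qed

lemma strict_linear_cases:
  "strict_linear R \<Longrightarrow> \<not> R x a \<Longrightarrow> a \<noteq> x \<Longrightarrow> R a x"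
  unfolding strict_linear_def by (metis totalpD)

text \<open>The two moves are combined: first \<open>x\<close> moves left until it stands next to
  the entry \<open>y\<close> that it bumps, then \<open>y\<close> moves to the front of the
  row.\<close>

lemma rins_knuth:
  assumes R: "strict_linear R" and r: "sorted_wrt R r" "x \<notin> set r"
    and i: "rins R r x = (r', Some y)"
  shows "knuth R (r @ [x]) (y # r')" "sorted_wrt R r'" "y \<notin> set r'"
proof -
  have tr: "transp R" and ir: "irreflp R" using R by (auto simp: strict_linear_def)
  obtain A B where rd: "r = A @ y # B" "r' = A @ x # B" "R x y" "\<And>a. a \<in> set A \<Longrightarrow> \<not> R x a"
    using i by (cases rule: rins_cases[of R r x]) auto
  have A: "R a x" if "a \<in> set A" for a
    using strict_linear_cases[OF R rd(4)[OF that]] that r(2) rd(1) by auto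
  have B: "R x b" if "b \<in> set B" for b
    using r(1) rd(1,3) that tr by (auto simp: sorted_wrt_append dest: transpD)
  have "knuth R (A @ (y # B @ [x])) (A @ (y # x # B))"
    by (intro knuth_appendL knuth_move_left) (use r rd tr in \<open>auto simp: sorted_wrt_append\<close>)
  moreover have "knuth R ((A @ [y, x]) @ B) ((y # A @ [x]) @ B)"
    by (intro knuth_appendR knuth_move_front) (use r rd A tr in \<open>auto simp: sorted_wrt_append\<close>)
  ultimately show "knuth R (r @ [x]) (y # r')" using rd by (auto intro: knuth.trans)
  show "sorted_wrt R r'" using r A B rd by (auto simp: sorted_wrt_append)
  show "y \<notin> set r'" using r A B rd ir tr by (auto simp: sorted_wrt_append dest: irreflpD)
qed

lemma rins_None:
  assumes R: "strict_linear R" and r: "sorted_wrt R r" "x \<notin> set r"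
    and i: "rins R r x = (r', None)"
  shows "r' = r @ [x]" "sorted_wrt R r'"
proof -
  have *: "r' = r @ [x]" "\<And>a. a \<in> set r \<Longrightarrow> \<not> R x a"
    using i by (cases rule: rins_cases[of R r x]; auto)+
  show "r' = r @ [x]" by fact
  show "sorted_wrt R r'" using * r strict_linear_cases[OF R] by (auto simp: sorted_wrt_append)
qed

text \<open>This is the column condition of a tableau for a row \<open>r\<close> and a row
  \<open>s\<close> below it.\<close>

definition dominates :: "('a \<Rightarrow> 'a \<Rightarrow> bool) \<Rightarrow> 'a list \<Rightarrow> 'a list \<Rightarrow> bool" where
  "dominates R r s \<longleftrightarrow> length s \<le> length r \<and> (\<forall>j<length s. R (r ! j) (s ! j))"

fun tableau :: "('a \<Rightarrow> 'a \<Rightarrow> bool) \<Rightarrow> 'a list list \<Rightarrow> bool" where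
  "tableau R [] = True"
| "tableau R (r # T) \<longleftrightarrow> r \<noteq> [] \<and> sorted_wrt R r \<and> (T \<noteq> [] \<longrightarrow> dominates R r (hd T)) \<and> tableau R T"

text \<open>A bumped entry never moves to the right: whatever stands below the old cell of
  \<open>y\<close> exceeds \<open>y\<close>, so \<open>y\<close> lands weakly to the left of that
  cell. The entries of \<open>r'\<close> there are smaller than \<open>y\<close>, and elsewhere the
  column condition is inherited, since the upper row changes only by replacing \<open>y\<close> with
  the smaller \<open>x\<close>.\<close>

lemma rins_dominates:
  assumes R: "strict_linear R" and r: "sorted_wrt R r" "x \<notin> set r"
    and s: "sorted_wrt R s" "y \<notin> set s" "dominates R r s"
    and i: "rins R r x = (r', Some y)"
  shows "dominates R r' (fst (rins R s y))"
proof -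
  have tr: "\<And>a b c. R a b \<Longrightarrow> R b c \<Longrightarrow> R a c" and ir: "\<And>a. \<not> R a a"
    using R by (auto simp: strict_linear_def dest: transpD irreflpD)
  obtain A B where rd: "r = A @ y # B" "r' = A @ x # B" "R x y" "\<And>a. a \<in> set A \<Longrightarrow> \<not> R x a"
    using i by (cases rule: rins_cases[of R r x]) auto
  have sd: "length s \<le> length r" "\<And>j. j < length s \<Longrightarrow> R (r ! j) (s ! j)"
    using s(3) by (auto simp: dominates_def)
  have r': "R (r' ! j) (s ! j)" if "j < length s" for j
  proof (cases "j = length A")
    case True
    then show ?thesis using sd(2)[OF that] rd(1-3) tr by auto
  next
    case False
    then have "r' ! j = r ! j" using rd by (auto simp: nth_append nth_Cons')
    then show ?thesis using sd(2)[OF that] by simp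
  qed
  have yA: "R (r' ! j) y" if "j \<le> length A" for j
  proof (cases "j = length A")
    case False
    then have "r' ! j \<in> set A" using rd that by (auto simp: nth_append)
    then show ?thesis using r(1) rd(1) by (auto simp: sorted_wrt_append)
  qed (use rd in auto)
  show ?thesis
  proof (cases rule: rins_cases[of R s y])
    case append
    have "length s \<le> length A"
    proof (rule ccontr)
      assume *: "\<not> length s \<le> length A"
      then have "R y (s ! length A)" using sd(2)[of "length A"] rd(1) by simp
      moreover have "s ! length A \<in> set s" using * by simp
      ultimately show False using append(2) by blast
    qed
    then show ?thesis unfolding dominates_def append using rd(1,2) r' yA
      by (auto simp: nth_append less_Suc_eq)
  next
    case (bump C z D)
    have "length C \<le> length A"
    proof (rule ccontr)
      assume *: "\<not> length C \<le> length A"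
      then have "R y (s ! length A)" using sd(2)[of "length A"] rd(1) bump(1) by simp
      moreover have "s ! length A \<in> set C" using * bump(1) by (simp add: nth_append)
      ultimately show False using bump(4) by blast
    qed
    moreover have "length r' = length r" using rd by simp
    moreover have "(C @ y # D) ! j = (if j = length C then y else s ! j)" for j
      using bump(1) by (auto simp: nth_append nth_Cons')
    ultimately show ?thesis unfolding dominates_def using bump(1,2) sd(1) r' yA by auto
  qed
qed

lemma tins_mset: "mset (concat (tins R T x)) = add_mset x (mset (concat T))"
proof (induction T arbitrary: x)
  case (Cons r T)
  show ?case by (cases rule: rins_cases[of R r x]) (use Cons in auto)
qed auto

lemma tins_set: "set (concat (tins R T x)) = insert x (set (concat T))"
  using tins_mset[of R T x] by (metis set_mset_add_mset_insert set_mset_mset)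

lemma hd_tins: "hd (tins R T x) = (if T = [] then [x] else fst (rins R (hd T) x))"
  by (cases T) (auto split: prod.splits option.splits)

lemma tins_not_Nil: "tins R T x \<noteq> []"
  by (cases T) (auto split: prod.splits option.splits)

text \<open>The Knuth moves inside the first row bring the bumped entry to the end of the reading
  word of the lower rows. There the induction hypothesis applies, with \<open>r'\<close> as an
  unchanged suffix.\<close>

lemma tins_tableau:
  assumes R: "strict_linear R" and "tableau R T" "distinct (x # concat T)"
  shows "tableau R (tins R T x) \<and> knuth R (reading T @ [x]) (reading (tins R T x))"
  using assms(2,3)
proof (induction T arbitrary: x)
  case Nil
  then show ?case by (simp add: reading_def knuth.refl)
next
  case (Cons r T)
  have r: "sorted_wrt R r" "x \<notin> set r" "r \<noteq> []" using Cons.prems by auto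
  show ?case
  proof (cases "rins R r x")
    case (Pair r' o')
    show ?thesis
    proof (cases o')
      case None
      then have i: "rins R r x = (r', None)" using Pair by simp
      from rins_None[OF R r(1,2) i] show ?thesis using Cons.prems
        by (auto simp: i reading_def knuth.refl dominates_def nth_append)
    next
      case (Some y)
      then have i: "rins R r x = (r', Some y)" using Pair by simp
      note rk = rins_knuth[OF R r(1,2) i]
      have yr: "y \<in> set r"
        using i by (cases rule: rins_cases[of R r x]) auto
      have d: "distinct (y # concat T)" using Cons.prems yr by auto
      have IH: "tableau R (tins R T y)" "knuth R (reading T @ [y]) (reading (tins R T y))"
        using Cons.IH[OF _ d] Cons.prems by auto
      have "r' \<noteq> []" using i by (cases rule: rins_cases[of R r x]) auto
      moreover have "dominates R r' (hd (tins R T y))"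
      proof (cases T)
        case Nil
        obtain A B where rd: "r = A @ y # B" "r' = A @ x # B" "R x y"
          using i by (cases rule: rins_cases[of R r x]) auto
        have "R (r' ! 0) y" using rd r(1) by (cases A) (auto simp: sorted_wrt_append)
        then show ?thesis unfolding Nil using rd by (auto simp: dominates_def)
      next
        case (Cons s T')
        have "sorted_wrt R s" "y \<notin> set s" "dominates R r s" using Cons.prems d Cons by auto
        from rins_dominates[OF R r(1,2) this i] show ?thesis unfolding hd_tins Cons by simp
      qed
      ultimately have "tableau R (r' # tins R T y)" using rk IH tins_not_Nil by auto
      moreover have "knuth R (reading T @ (r @ [x])) (reading T @ (y # r'))"
        by (intro knuth_appendL rk)
      then have "knuth R (reading T @ r @ [x]) (reading (tins R T y) @ r')"
        using knuth_appendR[OF IH(2), of r'] by (auto intro: knuth.trans)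
      ultimately show ?thesis by (simp add: i reading_def)
    qed
  qed
qed

text \<open>Since chain sizes are invariant under Knuth moves, this reduces their computation for a
  word to the reading word of its insertion tableau.\<close>

lemma foldl_tins_tableau:
  assumes R: "strict_linear R" and "distinct u"
  shows "tableau R (foldl (tins R) [] u) \<and> knuth R u (reading (foldl (tins R) [] u))
    \<and> mset (concat (foldl (tins R) [] u)) = mset u"
  using assms(2)
proof (induction u rule: rev_induct)
  case Nil
  then show ?case by (simp add: reading_def knuth.refl)
next
  case (snoc x u)
  define T where "T = foldl (tins R) [] u"
  have IH: "tableau R T" "knuth R u (reading T)" "mset (concat T) = mset u"
    using snoc by (auto simp: T_def)
  have "distinct (x # concat T)" using snoc.prems IH(3)
    by (metis append_Nil2 distinct.simps(2) distinct1_rotate mset_eq_imp_distinct_iff mset_eq_setD rotate1.simps(2))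
  from tins_tableau[OF R IH(1) this] show ?case
    using knuth_appendR[OF IH(2), of "[x]"] tins_mset[of R T x] IH(3)
    by (auto simp: T_def[symmetric] intro: knuth.trans)
qed

section \<open>Greene's theorem for the reading word of a tableau\<close>

lemma sorted_wrt_linked:
  assumes "sorted_wrt P xs" "sorted_wrt Q xs" "a \<in> set xs" "b \<in> set xs" "a \<noteq> b"
  shows "P a b \<and> Q a b \<or> P b a \<and> Q b a"
proof -
  obtain i j where "i < length xs" "j < length xs" "xs ! i = a" "xs ! j = b" "i \<noteq> j"
    using assms(3-5) by (metis in_set_conv_nth)
  then show ?thesis using assms(1,2) unfolding sorted_wrt_iff_nth_less
    by (metis linorder_neqE_nat)
qed

text \<open>The cells of a Young diagram, listed so that rows are increasing and columns are not: a chain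
  meets every column at most once, hence \<open>k\<close> chains cover at most as much as the first \<open>k\<close> rows.\<close>

lemma grid_chain_sizes:
  fixes row col :: "'c \<Rightarrow> nat"
  assumes L: "distinct L"
    and young: "\<And>a i. a \<in> set L \<Longrightarrow> i \<le> row a \<Longrightarrow> \<exists>b\<in>set L. row b = i \<and> col b = col a"
    and P: "sorted_wrt (\<lambda>a b. (row a = row b \<longrightarrow> R a b) \<and> (col a = col b \<longrightarrow> \<not> R a b)) L"
  shows "card {a \<in> set L. row a < k} \<in> chain_sizes R k L"
    and "m \<in> chain_sizes R k L \<Longrightarrow> m \<le> card {a \<in> set L. row a < k}"
proof -
  have len: "length (filter Q L) = card {a \<in> set L. Q a}" for Q
    using L by (metis distinct_card distinct_filter set_filter)
  show "card {a \<in> set L. row a < k} \<in> chain_sizes R k L"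
  proof (rule chain_sizes_I[where f = row])
    fix c assume "c < k"
    have "sorted_wrt (\<lambda>a b. (row a = row b \<longrightarrow> R a b) \<and> (col a = col b \<longrightarrow> \<not> R a b)) (filter (\<lambda>x. row x = c) L)"
      by (rule sorted_wrt_filter[OF P])
    then show "sorted_wrt R (filter (\<lambda>x. row x = c) L)"
      by (rule sorted_wrt_mono_rel[rotated]) auto
  qed (simp add: len)
  assume "m \<in> chain_sizes R k L"
  then obtain f where f: "\<And>c. c < k \<Longrightarrow> sorted_wrt R (filter (\<lambda>x. f x = c) L)"
    and m: "m = card {a \<in> set L. f a < k}"
    unfolding chain_sizes_def len by blast
  let ?J = "col ` set L"
  \<comment> \<open>The comparison is made column by column. A column with no cell at height
    \<open>k\<close> or beyond lies entirely in the first \<open>k\<close> rows; any other column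
    has a cell in each of these rows, while the chains take at most \<open>k\<close> of its
    cells.\<close>
  have col_le: "card {a \<in> {a \<in> set L. f a < k}. col a = j} \<le> card {a \<in> {a \<in> set L. row a < k}. col a = j}" for j
  proof (cases "\<exists>a\<in>set L. col a = j \<and> k \<le> row a")
    case False
    then show ?thesis by (intro card_mono) (auto simp: not_le)
  next
    case True
    then obtain a where a: "a \<in> set L" "col a = j" "k \<le> row a" by auto
    \<comment> \<open>Two cells of one column in the same chain would be related by \<open>R\<close>
      in the direction of the list, which \<open>P\<close> forbids.\<close>
    have "inj_on f {a \<in> {a \<in> set L. f a < k}. col a = j}"
    proof (rule inj_onI, rule ccontr)
      fix x y assume xy: "x \<in> {a \<in> {a \<in> set L. f a < k}. col a = j}" "y \<in> {a \<in> {a \<in> set L. f a < k}. col a = j}"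
        "f x = f y" "x \<noteq> y"
      have "f x < k" using xy by auto
      from sorted_wrt_linked[OF sorted_wrt_filter[OF P] f[OF this], of x y] xy
      show False by auto
    qed
    then have "card {a \<in> {a \<in> set L. f a < k}. col a = j} \<le> card {..<k}"
      by (rule card_inj_on_le) auto
    also have "{..<k} \<subseteq> row ` {a \<in> {a \<in> set L. row a < k}. col a = j}"
    proof
      fix i assume "i \<in> {..<k}"
      then have "i \<le> row a" using a by auto
      from young[OF a(1) this] \<open>i \<in> {..<k}\<close> a show "i \<in> row ` {a \<in> {a \<in> set L. row a < k}. col a = j}"
        by auto
    qed
    then have "card {..<k} \<le> card {a \<in> {a \<in> set L. row a < k}. col a = j}"
      by (rule surj_card_le[rotated]) auto
    finally show ?thesis .
  qed
  have grp: "(\<Sum>j\<in>?J. card {a \<in> {a \<in> set L. Q a}. col a = j}) = card {a \<in> set L. Q a}" for Q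
    using sum.group[of "{a \<in> set L. Q a}" ?J col "\<lambda>_. 1::nat"] by auto
  have "m = (\<Sum>j\<in>?J. card {a \<in> {a \<in> set L. f a < k}. col a = j})" unfolding m grp ..
  also have "\<dots> \<le> (\<Sum>j\<in>?J. card {a \<in> {a \<in> set L. row a < k}. col a = j})"
    by (intro sum_mono col_le)
  also have "\<dots> = card {a \<in> set L. row a < k}" by (rule grp)
  finally show "m \<le> card {a \<in> set L. row a < k}" .
qed

text \<open>This allows cells to be coloured in place of their entries. Distinct entries make
  \<open>e\<close> injective on the cells, so colourings can be carried over in both
  directions.\<close>

lemma chain_sizes_map:
  assumes "distinct (map e L)"
  shows "chain_sizes R k (map e L) = chain_sizes (\<lambda>a b. R (e a) (e b)) k L"
proof
  show "chain_sizes R k (map e L) \<subseteq> chain_sizes (\<lambda>a b. R (e a) (e b)) k L"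
    unfolding chain_sizes_def by (auto simp: filter_map o_def sorted_wrt_map)
  show "chain_sizes (\<lambda>a b. R (e a) (e b)) k L \<subseteq> chain_sizes R k (map e L)"
  proof
    fix m assume "m \<in> chain_sizes (\<lambda>a b. R (e a) (e b)) k L"
    then obtain f where f: "\<And>c. c < k \<Longrightarrow> sorted_wrt (\<lambda>a b. R (e a) (e b)) (filter (\<lambda>x. f x = c) L)"
      and m: "m = length (filter (\<lambda>x. f x < k) L)"
      unfolding chain_sizes_def by blast
    have inv: "inv_into (set L) e (e x) = x" if "x \<in> set L" for x
      using assms that by (simp add: distinct_map)
    have "filter (\<lambda>x. Q (f (inv_into (set L) e x))) (map e L) = map e (filter (\<lambda>x. Q (f x)) L)" for Q
      proof -
      have "filter (\<lambda>x. Q (f (inv_into (set L) e (e x)))) L = filter (\<lambda>x. Q (f x)) L"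
        using inv by (metis (no_types, lifting) filter_cong)
      then show ?thesis by (simp add: filter_map comp_def)
    qed
    note fm = this
    show "m \<in> chain_sizes R k (map e L)"
    proof (rule chain_sizes_I[where f = "\<lambda>x. f (inv_into (set L) e x)"])
      show "sorted_wrt R (filter (\<lambda>x. f (inv_into (set L) e x) = c) (map e L))" if "c < k" for c
        unfolding fm[of "\<lambda>d. d = c"] sorted_wrt_map by (rule f[OF that])
      show "m = length (filter (\<lambda>x. f (inv_into (set L) e x) < k) (map e L))"
        unfolding fm[of "\<lambda>d. d < k"] length_map by (rule m)
    qed
  qed
qed

definition cells :: "'a list list \<Rightarrow> (nat \<times> nat) set" where
  "cells T = Sigma {..<length T} (\<lambda>i. {..<length (T ! i)})"

text \<open>The cells are listed in the order of the reading word. The row lengths are a separate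
  function \<open>l\<close>, so that induction on the number of rows is possible.\<close>

definition cell_list :: "(nat \<Rightarrow> nat) \<Rightarrow> nat \<Rightarrow> (nat \<times> nat) list" where
  "cell_list l n = concat (rev (map (\<lambda>i. map (Pair i) [0..<l i]) [0..<n]))"

lemma cell_list_Suc: "cell_list l (Suc n) = map (Pair n) [0..<l n] @ cell_list l n"
  by (simp add: cell_list_def)

lemma set_cell_list: "set (cell_list l n) = Sigma {..<n} (\<lambda>i. {..<l i})"
  by (auto simp: cell_list_def)

lemma sorted_cell_list: "sorted_wrt (\<lambda>(i, j) (i', j'). i' < i \<or> i = i' \<and> j < j') (cell_list l n)"
proof (induction n)
  case (Suc n)
  then show ?case by (auto simp: cell_list_Suc sorted_wrt_append sorted_wrt_map set_cell_list)
qed (simp add: cell_list_def)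

lemma reading_cell_list: "reading T = map (\<lambda>(i, j). T ! i ! j) (cell_list (\<lambda>i. length (T ! i)) (length T))"
proof -
  have T: "map (\<lambda>i. map (\<lambda>j. T ! i ! j) [0..<length (T ! i)]) [0..<length T] = T"
    by (simp add: map_nth)
  have "reading T = concat (rev (map (\<lambda>i. map (\<lambda>j. T ! i ! j) [0..<length (T ! i)]) [0..<length T]))"
    unfolding T reading_def ..
  also have "\<dots> = map (\<lambda>(i, j). T ! i ! j) (cell_list (\<lambda>i. length (T ! i)) (length T))"
    unfolding cell_list_def map_concat by (simp add: comp_def rev_map)
  finally show ?thesis .
qed

lemma tableau_dominates:
  assumes "transp R" "tableau R T"
  shows "sorted_wrt (dominates R) T"
proof -
  have tr: "transp (dominates R)"
    using assms(1) unfolding dominates_def transp_def by (meson le_trans less_le_trans)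
  show ?thesis using assms(2)
  proof (induction T)
    case (Cons r T)
    then show ?case by (cases T) (auto simp: sorted_wrt2[OF tr] sorted_wrt1 simp del: sorted_wrt.simps(2))
  qed simp
qed

lemma tableau_rows: "tableau R T \<Longrightarrow> r \<in> set T \<Longrightarrow> sorted_wrt R r"
  by (induction T) auto

theorem greene_tableau:
  assumes R: "strict_linear R" and T: "tableau R T" "distinct (reading T)"
  shows "card {a \<in> cells T. fst a < k} \<in> chain_sizes R k (reading T)"
    and "m \<in> chain_sizes R k (reading T) \<Longrightarrow> m \<le> card {a \<in> cells T. fst a < k}"
    and "card {a \<in> cells T. snd a < k} \<in> chain_sizes R\<inverse>\<inverse> k (reading T)"
    and "m \<in> chain_sizes R\<inverse>\<inverse> k (reading T) \<Longrightarrow> m \<le> card {a \<in> cells T. snd a < k}"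
proof -
  let ?e = "\<lambda>(i, j). T ! i ! j"
  define L where "L = cell_list (\<lambda>i. length (T ! i)) (length T)"
  have rd: "reading T = map ?e L" unfolding L_def by (rule reading_cell_list)
  have setL: "set L = cells T" by (simp add: L_def set_cell_list cells_def)
  have dL: "distinct L" "distinct (map ?e L)" using T(2) unfolding rd by (auto simp: distinct_map)
  have tr: "transp R" and asym: "\<And>a b. R a b \<Longrightarrow> \<not> R b a"
    using R by (auto simp: strict_linear_def dest: transpD irreflpD)
  have dom: "dominates R (T ! i) (T ! i')" if "i < i'" "i' < length T" for i i'
    using tableau_dominates[OF tr T(1)] that by (simp add: sorted_wrt_iff_nth_less)
  have row: "R (T ! i ! j) (T ! i ! j')" if "i < length T" "j < j'" "j' < length (T ! i)" for i j j'
    using tableau_rows[OF T(1), of "T ! i"] that by (simp add: sorted_wrt_iff_nth_less)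
  have col: "R (T ! i ! j) (T ! i' ! j)" if "i < i'" "i' < length T" "j < length (T ! i')" for i i' j
    using dom[OF that(1,2)] that(3) by (simp add: dominates_def)
  have down: "(i, j') \<in> cells T" if "(i', j) \<in> cells T" "i \<le> i'" "j' \<le> j" for i i' j j'
  proof (cases "i = i'")
    case False
    then show ?thesis using dom[of i i'] that by (auto simp: cells_def dominates_def)
  qed (use that in \<open>auto simp: cells_def\<close>)
  have sorted: "sorted_wrt (\<lambda>a b. (fst a = fst b \<longrightarrow> R (?e a) (?e b)) \<and> (snd a = snd b \<longrightarrow> R (?e b) (?e a))) L"
    using sorted_cell_list[of "\<lambda>i. length (T ! i)" "length T"] unfolding L_def[symmetric]
    by (rule sorted_wrt_mono_rel[rotated]) (auto simp: setL cells_def intro: row col)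
  have A: "sorted_wrt (\<lambda>a b. (fst a = fst b \<longrightarrow> R (?e a) (?e b)) \<and> (snd a = snd b \<longrightarrow> \<not> R (?e a) (?e b))) L"
    using sorted by (rule sorted_wrt_mono_rel[rotated]) (auto dest: asym)
  \<comment> \<open>The same list is used for the converse order with the roles of rows and columns
    exchanged: in the reading word the columns are decreasing and the rows are not.\<close>
  have B: "sorted_wrt (\<lambda>a b. (snd a = snd b \<longrightarrow> R\<inverse>\<inverse> (?e a) (?e b)) \<and> (fst a = fst b \<longrightarrow> \<not> R\<inverse>\<inverse> (?e a) (?e b))) L"
    using sorted by (rule sorted_wrt_mono_rel[rotated]) (auto dest: asym)
  have yA: "\<exists>b\<in>set L. fst b = i \<and> snd b = snd a" if "a \<in> set L" "i \<le> fst a" for a i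
    using that down[of "fst a" "snd a" i "snd a"] unfolding setL by (intro bexI[of _ "(i, snd a)"]) auto
  have yB: "\<exists>b\<in>set L. snd b = i \<and> fst b = fst a" if "a \<in> set L" "i \<le> snd a" for a i
    using that down[of "fst a" "snd a" "fst a" i] unfolding setL by (intro bexI[of _ "(fst a, i)"]) auto
  note gA = grid_chain_sizes[OF dL(1) yA A, where k = k, unfolded setL]
  note gB = grid_chain_sizes[OF dL(1) yB B, where k = k, unfolded setL]
  show "card {a \<in> cells T. fst a < k} \<in> chain_sizes R k (reading T)"
    "m \<in> chain_sizes R k (reading T) \<Longrightarrow> m \<le> card {a \<in> cells T. fst a < k}"
    unfolding rd chain_sizes_map[OF dL(2)] using gA by auto
  show "card {a \<in> cells T. snd a < k} \<in> chain_sizes R\<inverse>\<inverse> k (reading T)"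
    "m \<in> chain_sizes R\<inverse>\<inverse> k (reading T) \<Longrightarrow> m \<le> card {a \<in> cells T. snd a < k}"
    unfolding rd chain_sizes_map[OF dL(2)] using gB by auto
qed

section \<open>Standardisation, and Greene's theorem for the generalised RSK shape\<close>

lemma sum_row_len: "(\<Sum>i=1..k. row_len (map length T) i) = card {a \<in> cells T. fst a < k}"
proof -
  have "{a \<in> cells T. fst a < k} = Sigma ({..<k} \<inter> {..<length T}) (\<lambda>i. {..<length (T ! i)})"
    by (auto simp: cells_def)
  then have "card {a \<in> cells T. fst a < k} = (\<Sum>i\<in>{..<k} \<inter> {..<length T}. length (T ! i))"
    by simp
  also have "\<dots> = (\<Sum>i<k. row_len (map length T) (Suc i))"
    by (intro sum.mono_neutral_cong_left) (auto simp: row_len_def)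
  finally show ?thesis by (simp add: sum.atLeast1_atMost_eq)
qed

lemma sum_col_len: "(\<Sum>j=1..k. col_len (map length T) j) = card {a \<in> cells T. snd a < k}"
proof -
  have "{a \<in> cells T. snd a < k} = prod.swap ` Sigma {..<k} (\<lambda>j. {i. i < length T \<and> j < length (T ! i)})"
    by (force simp: cells_def image_iff)
  then have "card {a \<in> cells T. snd a < k} = card (Sigma {..<k} (\<lambda>j. {i. i < length T \<and> j < length (T ! i)}))"
    by (simp add: card_image)
  also have "\<dots> = (\<Sum>j<k. card {i. i < length T \<and> j < length (T ! i)})" by simp
  also have "\<dots> = (\<Sum>j<k. col_len (map length T) (Suc j))"
    by (intro sum.cong refl) (auto simp: col_len_def length_filter_conv_card Suc_le_eq intro!: arg_cong[of _ _ card])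
  finally show ?thesis by (simp add: sum.atLeast1_atMost_eq)
qed

text \<open>The order of the positions of a word that standardises it: equal letters of \<open>Le_set\<close> are
  ordered from left to right, all other equal letters from right to left.\<close>

definition prec :: "letter rel \<Rightarrow> (nat \<Rightarrow> letter) \<Rightarrow> nat \<Rightarrow> nat \<Rightarrow> bool" where
  "prec p w a b \<longleftrightarrow> (w a, w b) \<in> p \<and> w a \<noteq> w b \<or> w a = w b \<and> (if w a \<in> Le_set then a < b else b < a)"

lemma strict_linear_prec:
  assumes p: "linear_order_on Alph p" and w: "\<And>i. w i \<in> Alph"
  shows "strict_linear (prec p w)"
proof -
  have p': "antisym p" "trans p" "total_on Alph p" using p by (auto simp: order_on_defs)
  show ?thesis unfolding strict_linear_def
  proof (intro conjI)
    show "irreflp (prec p w)" by (auto simp: irreflp_def prec_def)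
    show "totalp (prec p w)"
    proof (rule totalpI)
      fix a b :: nat assume "a \<noteq> b"
      then show "prec p w a b \<or> prec p w b a"
        using p'(3) w[of a] w[of b] unfolding total_on_def prec_def by (metis linorder_neqE_nat)
    qed
    show "transp (prec p w)"
    proof (rule transpI)
      fix a b c assume *: "prec p w a b" "prec p w b c"
      show "prec p w a c"
      proof (cases "w a = w b \<or> w b = w c")
        case True
        with * show ?thesis unfolding prec_def by (auto split: if_splits)
      next
        case False
        with * have "(w a, w b) \<in> p" "(w b, w c) \<in> p" by (auto simp: prec_def)
        then show ?thesis using p'(1,2) False unfolding prec_def by (metis antisymD transD)
      qed
    qed
  qed
qed

lemma rins_map:
  assumes "\<And>y. y \<in> set r \<Longrightarrow> bumps p (w x) (w y) \<longleftrightarrow> R x y"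
  shows "row_insert p (map w r) (w x) = map_prod (map w) (map_option w) (rins R r x)"
  using assms by (induction r) (auto split: prod.splits)

text \<open>Equal letters are bumped in the order of their positions; this invariant makes insertion of
  positions agree with insertion of letters also when an entry is bumped into a lower row.\<close>

fun standard :: "(nat \<Rightarrow> letter) \<Rightarrow> nat list list \<Rightarrow> bool" where
  "standard w [] = True"
| "standard w (r # T) \<longleftrightarrow> (\<forall>a\<in>set r. \<forall>b\<in>set r. w a = w b \<longrightarrow> a \<noteq> b \<longrightarrow> w a \<in> Le_set) \<and>
     (\<forall>a\<in>set r. \<forall>b\<in>set (concat T). w a = w b \<longrightarrow> b < a) \<and> standard w T"

text \<open>The inserted position is later than all positions of the tableau that carry the same
  letter. On an equal letter \<open>prec\<close> then bumps exactly when that letter is not in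
  \<open>Le_set\<close>, as \<open>bumps\<close> does, so the two insertions agree row by row. The
  work lies in showing that a bumped position is again later than its equals in the rows
  below.\<close>

lemma tins_standard:
  assumes p: "linear_order_on Alph p" and w: "\<And>i. w i \<in> Alph"
    and "tableau (prec p w) T" "standard w T" "distinct (x # concat T)"
    and "\<And>b. b \<in> set (concat T) \<Longrightarrow> w b = w x \<Longrightarrow> b < x"
  shows "tab_insert p (map (map w) T) (w x) = map (map w) (tins (prec p w) T x)
    \<and> standard w (tins (prec p w) T x)"
  using assms(3-)
proof (induction T arbitrary: x)
  case Nil
  then show ?case by simp
next
  case (Cons r T)
  let ?R = "prec p w"
  have R: "strict_linear ?R" by (rule strict_linear_prec[OF p w])
  have as: "antisym p" and re: "\<And>i. (w i, w i) \<in> p" and tr: "trans p"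
    using p w by (auto simp: order_on_defs refl_on_def)
  have tr': "transp ?R" using R by (simp add: strict_linear_def)
  have Rp: "(w a, w b) \<in> p" if "?R a b" for a b using that re by (auto simp: prec_def)
  have st: "\<And>a b. a \<in> set r \<Longrightarrow> b \<in> set r \<Longrightarrow> w a = w b \<Longrightarrow> a \<noteq> b \<Longrightarrow> w a \<in> Le_set"
    "\<And>a b. a \<in> set r \<Longrightarrow> b \<in> set (concat T) \<Longrightarrow> w a = w b \<Longrightarrow> b < a" "standard w T"
    using Cons.prems(2) by auto
  have late: "\<And>b. b \<in> set r \<Longrightarrow> w b = w x \<Longrightarrow> b < x" "\<And>b. b \<in> set (concat T) \<Longrightarrow> w b = w x \<Longrightarrow> b < x"
    using Cons.prems(4) by auto
  have r: "sorted_wrt ?R r" "x \<notin> set r" using Cons.prems by auto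
  have b: "bumps p (w x) (w y) \<longleftrightarrow> ?R x y" if "y \<in> set r" for y
    using late(1)[OF that] re unfolding bumps_def prec_def by auto
  note ri = rins_map[of r p w x ?R, OF b]
  show ?case
  proof (cases rule: rins_cases[of ?R r x])
    case append
    have l: "w a \<in> Le_set" if "a \<in> set r" "w a = w x" for a
      using append(2)[OF that(1)] that late(1)[OF that] unfolding prec_def by (metis (full_types))
    have "\<forall>a\<in>set (r @ [x]). \<forall>b\<in>set (r @ [x]). w a = w b \<longrightarrow> a \<noteq> b \<longrightarrow> w a \<in> Le_set"
      using l st(1) by (simp add: ball_Un) metis
    moreover have "\<forall>a\<in>set (r @ [x]). \<forall>b\<in>set (concat T). w a = w b \<longrightarrow> b < a"
      using late(2) st(2) by (simp add: ball_Un) metis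
    ultimately have "standard w ((r @ [x]) # T)" using st(3) by simp
    then show ?thesis by (simp add: ri append(1))
  next
    case (bump A y B)
    have y: "y \<in> set r" using bump by simp
    have IH: "tab_insert p (map (map w) T) (w y) = map (map w) (tins ?R T y) \<and> standard w (tins ?R T y)"
    proof (rule Cons.IH)
      show "tableau ?R T" "distinct (y # concat T)" using Cons.prems y by auto
      show "b < y" if "b \<in> set (concat T)" "w b = w y" for b using st(2)[OF y that(1)] that(2) by simp
    qed (rule st(3))
    \<comment> \<open>A letter outside \<open>Le_set\<close> bumps an equal letter \<open>a\<close>.
      If the bumped entry were another position \<open>y\<close> to the left of \<open>a\<close>,
      its letter would be squeezed between two equal ones, and the row would already contain a
      forbidden repetition.\<close>
    have s1: "w x \<in> Le_set" if "a \<in> set A \<union> set B" "w a = w x" for a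
    proof (rule ccontr)
      assume n: "w x \<notin> Le_set"
      have ar: "a \<in> set r" using that bump(1) by auto
      then have "?R x a" using n that(2) late(1)[OF ar] unfolding prec_def by auto
      then have "a \<in> set B" using bump(4) that by auto
      then have "?R y a" using bump(1) r(1) by (auto simp: sorted_wrt_append)
      then have "w y = w a" using Rp[OF bump(3)] Rp[of y a] that(2) as by (auto dest: antisymD)
      moreover have "a \<noteq> y" using \<open>a \<in> set B\<close> Cons.prems(3) bump(1) by auto
      ultimately show False using st(1)[OF y ar] that n by auto
    qed
    \<comment> \<open>An equal letter to the right of \<open>y\<close> is later by the order of the
      row. One to the left would force the letter of \<open>x\<close> to be equal as well, and then
      \<open>x\<close> would bump a position of \<open>Le_set\<close> that is earlier than itself,
      against \<open>prec\<close>.\<close>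
    have s2: "y < a" if "a \<in> set A \<union> set B" "w a = w y" for a
    proof -
      have ar: "a \<in> set r" using that bump(1) by auto
      have "a \<noteq> y" using that Cons.prems(3) bump(1) by auto
      then have le: "w y \<in> Le_set" using st(1)[OF y ar] that by auto
      show ?thesis
      proof (cases "a \<in> set B")
        case True
        then have "?R y a" using bump(1) r(1) by (auto simp: sorted_wrt_append)
        then show ?thesis using that le by (auto simp: prec_def)
      next
        case False
        then have "?R a x" using strict_linear_cases[OF R bump(4)] that ar r(2) by auto
        then have "w x = w y" using Rp[OF bump(3)] Rp[of a x] that(2) as by (auto dest: antisymD)
        then show ?thesis using bump(3) le late(1)[OF y] by (auto simp: prec_def)
      qed
    qed
    let ?r' = "A @ x # B" and ?T' = "tins ?R T y"
    have sr: "set r = insert y (set A \<union> set B)" "set ?r' = insert x (set A \<union> set B)" using bump(1) by auto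
    have "\<forall>a\<in>set ?r'. \<forall>b\<in>set ?r'. w a = w b \<longrightarrow> a \<noteq> b \<longrightarrow> w a \<in> Le_set"
      using s1 st(1) unfolding sr by (metis insertCI insertE)
    moreover have "\<forall>a\<in>set ?r'. \<forall>b\<in>set (concat ?T'). w a = w b \<longrightarrow> b < a"
      using s2 st(2) late unfolding sr tins_set by (metis insertCI insertE)
    ultimately have "standard w (?r' # ?T')" using IH by simp
    then show ?thesis using IH by (simp add: ri bump(2))
  qed
qed

lemma RSK_standard:
  assumes p: "linear_order_on Alph p" and w: "\<And>i. w i \<in> Alph"
  shows "RSK p (word n w) = map (map w) (foldl (tins (prec p w)) [] [0..<n])
    \<and> standard w (foldl (tins (prec p w)) [] [0..<n])"
proof (induction n)
  case (Suc n)
  have R: "strict_linear (prec p w)" by (rule strict_linear_prec[OF p w])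
  let ?T = "foldl (tins (prec p w)) [] [0..<n]"
  have T: "tableau (prec p w) ?T" "mset (concat ?T) = mset [0..<n]"
    using foldl_tins_tableau[OF R, of "[0..<n]"] by auto
  have "set (concat ?T) = {0..<n}" using T(2) by (metis mset_eq_setD set_upt)
  moreover have "distinct (concat ?T)" using T(2) by (metis distinct_upt mset_eq_imp_distinct_iff)
  ultimately have "tab_insert p (map (map w) ?T) (w n) = map (map w) (tins (prec p w) ?T n)
    \<and> standard w (tins (prec p w) ?T n)"
    by (intro tins_standard[OF p w T(1)]) (use Suc in auto)
  then show ?case using Suc by (simp add: RSK_def word_def)
qed (simp add: RSK_def word_def)

theorem greene_phi:
  assumes p: "linear_order_on Alph p" and w: "\<And>i. w i \<in> Alph"
  shows "(\<Sum>i=1..k. row_len (phi p (word n w)) i) \<in> chain_sizes (prec p w) k [0..<n]"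
    and "m \<in> chain_sizes (prec p w) k [0..<n] \<Longrightarrow> m \<le> (\<Sum>i=1..k. row_len (phi p (word n w)) i)"
    and "(\<Sum>j=1..k. col_len (phi p (word n w)) j) \<in> chain_sizes (prec p w)\<inverse>\<inverse> k [0..<n]"
    and "m \<in> chain_sizes (prec p w)\<inverse>\<inverse> k [0..<n] \<Longrightarrow> m \<le> (\<Sum>j=1..k. col_len (phi p (word n w)) j)"
proof -
  let ?R = "prec p w"
  define T where "T = foldl (tins ?R) [] [0..<n]"
  have R: "strict_linear ?R" by (rule strict_linear_prec[OF p w])
  have T: "tableau ?R T" "knuth ?R [0..<n] (reading T)"
    using foldl_tins_tableau[OF R, of "[0..<n]"] by (auto simp: T_def)
  have ph: "phi p (word n w) = map length T"
    using RSK_standard[OF p w] by (simp add: phi_def T_def comp_def)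
  have d: "distinct (reading T)" using knuth_distinct[OF T(2)] by simp
  have eq: "chain_sizes ?R k [0..<n] = chain_sizes ?R k (reading T)"
    "chain_sizes ?R\<inverse>\<inverse> k [0..<n] = chain_sizes ?R\<inverse>\<inverse> k (reading T)"
    using knuth_chain_sizes[OF T(2) R]
      knuth_chain_sizes[OF knuth_conversep[OF T(2)] strict_linear_conversep[OF R]] by auto
  show "(\<Sum>i=1..k. row_len (phi p (word n w)) i) \<in> chain_sizes (prec p w) k [0..<n]"
    "m \<in> chain_sizes (prec p w) k [0..<n] \<Longrightarrow> m \<le> (\<Sum>i=1..k. row_len (phi p (word n w)) i)"
    "(\<Sum>j=1..k. col_len (phi p (word n w)) j) \<in> chain_sizes (prec p w)\<inverse>\<inverse> k [0..<n]"
    "m \<in> chain_sizes (prec p w)\<inverse>\<inverse> k [0..<n] \<Longrightarrow> m \<le> (\<Sum>j=1..k. col_len (phi p (word n w)) j)"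
    unfolding eq ph sum_row_len sum_col_len using greene_tableau[OF R T(1) d] by auto
qed

section \<open>The excess of chains over a piecewise ordered alphabet\<close>

text \<open>Entry \<open>(j, i)\<close> of \<open>\<theta>\<close> is the time at which chain \<open>j\<close> leaves piece \<open>i\<close>, and \<open>history k m \<theta> t\<close> is
  the set of pieces on which the \<open>k\<close> chains sit at time \<open>t\<close>.\<close>

definition history :: "nat \<Rightarrow> nat \<Rightarrow> (nat \<times> nat \<Rightarrow> nat) \<Rightarrow> nat \<Rightarrow> nat set" where
  "history k m \<theta> t = (\<lambda>j. card {i. i < m \<and> \<theta> (j, i) \<le> t}) ` {..<k}"

definition deficient :: "nat \<Rightarrow> nat \<Rightarrow> nat set \<Rightarrow> nat \<Rightarrow> nat \<Rightarrow> (nat \<times> nat \<Rightarrow> nat) set" where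
  "deficient k m D a b =
     {\<theta> \<in> PiE ({..<k} \<times> {..<m}) (\<lambda>_. {a..b}). \<forall>t\<in>{a..<b}. \<not> D \<subseteq> history k m \<theta> t}"

text \<open>For a letter in piece \<open>x\<close> this is what chains sitting on \<open>H\<close>
  can collect minus its contribution to the occurrences in \<open>D\<close>. The pieces of
  \<open>E\<close> are left out because their total contribution is bounded separately.\<close>

definition gain :: "nat set \<Rightarrow> nat set \<Rightarrow> nat set \<Rightarrow> nat \<Rightarrow> real" where
  "gain D E H x = of_bool (x \<in> H - E) - of_bool (x \<in> D)"

lemma finite_deficient: "finite (deficient k m D a b)"
  unfolding deficient_def by (rule finite_subset[OF _ finite_PiE[of "{..<k} \<times> {..<m}" "\<lambda>_. {a..b}"]]) auto

lemma card_deficient: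
  assumes "a \<le> b"
  shows "card (deficient k m D a b) \<le> (b - a + 1) ^ (k * m)"
proof -
  have "card (deficient k m D a b) \<le> card (PiE ({..<k} \<times> {..<m}) (\<lambda>_. {a..b}))"
    by (intro card_mono finite_PiE) (auto simp: deficient_def)
  also have "\<dots> = (b - a + 1) ^ (k * m)"
    using assms by (simp add: card_PiE card_cartesian_product Suc_diff_le)
  finally show ?thesis .
qed

text \<open>A monotone trajectory is determined by the first times at which it exceeds each level,
  and its value at time \<open>t\<close> is the number of levels exceeded by then. The default value
  \<open>b\<close> stands for a level that is not exceeded inside the interval.\<close>

lemma deficient_exists:
  assumes h: "\<And>j s t. s \<le> t \<Longrightarrow> h j s \<le> h j t" "\<And>j t. h j t \<le> m" and "a \<le> b"
    and D: "\<And>t. t \<in> {a..<b} \<Longrightarrow> \<not> D \<subseteq> (\<lambda>j. h j t) ` {..<k}"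
  shows "\<exists>\<theta>\<in>deficient k m D a b. \<forall>t\<in>{a..<b}. history k m \<theta> t = (\<lambda>j. h j t) ` {..<k}"
proof -
  let ?S = "\<lambda>j i. insert b {t \<in> {a..<b}. i < h j t}"
  define \<theta> where "\<theta> = (\<lambda>(j, i)\<in>{..<k} \<times> {..<m}. Min (?S j i))"
  have \<theta>: "Min (?S j i) \<le> t \<longleftrightarrow> i < h j t" if "t \<in> {a..<b}" for i j t
  proof
    assume "Min (?S j i) \<le> t"
    moreover have "Min (?S j i) \<in> ?S j i" by (intro Min_in) auto
    ultimately show "i < h j t" using that h(1)[of "Min (?S j i)" t j] by auto
  next
    assume "i < h j t"
    then show "Min (?S j i) \<le> t" using that by (intro Min_le) auto
  qed
  have hist: "history k m \<theta> t = (\<lambda>j. h j t) ` {..<k}" if "t \<in> {a..<b}" for t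
    unfolding history_def
  proof (rule image_cong)
    fix j assume "j \<in> {..<k}"
    then have "{i. i < m \<and> \<theta> (j, i) \<le> t} = {..<h j t}"
      using \<theta>[OF that] h(2)[of j t] by (auto simp: \<theta>_def)
    then show "card {i. i < m \<and> \<theta> (j, i) \<le> t} = h j t" by simp
  qed simp
  have "Min (?S j i) \<in> {a..b}" for j i
  proof -
    have "Min (?S j i) \<in> ?S j i" by (intro Min_in) auto
    then show ?thesis using \<open>a \<le> b\<close> by auto
  qed
  then have "\<theta> \<in> deficient k m D a b"
    unfolding deficient_def using hist D by (auto simp: \<theta>_def)
  with hist show ?thesis by blast
qed

text \<open>When \<open>k\<close> trajectories cover a set of \<open>k\<close> pieces they occupy it
  bijectively, so the sum of their positions is the sum of \<open>D\<close>. This sum is the same at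
  times \<open>s\<close> and \<open>u\<close>, hence by monotonicity no trajectory has moved in
  between.\<close>

lemma squeezed_covering:
  fixes h :: "nat \<Rightarrow> nat \<Rightarrow> nat"
  assumes h: "\<And>j s t. s \<le> t \<Longrightarrow> h j s \<le> h j t" and D: "card D = k"
    and "s \<le> t" "t \<le> u"
    and cov: "D \<subseteq> (\<lambda>j. h j s) ` {..<k}" "D \<subseteq> (\<lambda>j. h j u) ` {..<k}"
  shows "(\<lambda>j. h j t) ` {..<k} = D"
proof -
  have full: "(\<lambda>j. h j v) ` {..<k} = D \<and> (\<Sum>j<k. h j v) = \<Sum>D" if "D \<subseteq> (\<lambda>j. h j v) ` {..<k}" for v
  proof -
    have "card ((\<lambda>j. h j v) ` {..<k}) \<le> k" using card_image_le[of "{..<k}"] by fastforce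
    then have eq: "D = (\<lambda>j. h j v) ` {..<k}" using that D by (intro card_seteq) auto
    then have "inj_on (\<lambda>j. h j v) {..<k}" using D by (intro eq_card_imp_inj_on) auto
    then show ?thesis using eq by (simp add: sum.reindex)
  qed
  have "h j s = h j u" if "j < k" for j
  proof (rule ccontr)
    assume "h j s \<noteq> h j u"
    then have "h j s < h j u" using h[of s u j] assms(3,4) by simp
    then have "(\<Sum>j<k. h j s) < (\<Sum>j<k. h j u)"
      using that h[of s u] assms(3,4) by (intro sum_strict_mono_ex1) auto
    then show False using full[OF cov(1)] full[OF cov(2)] by simp
  qed
  then have "h j t = h j s" if "j < k" for j
    using that h[of s t j] h[of t u j] assms(3,4) by (metis le_antisym)
  then have "(\<lambda>j. h j t) ` {..<k} = (\<lambda>j. h j s) ` {..<k}" by simp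
  then show ?thesis using full[OF cov(1)] by simp
qed

text \<open>\<open>k\<close> chains pass through the ordered pieces \<open>{..<m}\<close> monotonically, so the times at which they
  sit on all of the pieces \<open>D\<close> form an interval \<open>{s..<e}\<close>, during which they collect no more than
  the letters of \<open>D\<close>.\<close>

lemma chains_excess:
  fixes c f :: "nat \<Rightarrow> nat"
  assumes c: "\<And>t. t < n \<Longrightarrow> c t < m"
    and chain: "\<And>a b. a < b \<Longrightarrow> b < n \<Longrightarrow> f a = f b \<Longrightarrow> f a < k \<Longrightarrow> c a \<le> c b \<and> (c a = c b \<longrightarrow> c a \<notin> E)"
    and D: "card D = k" "D \<inter> E = {}" and E: "finite E"
  shows "\<exists>s\<le>n. \<exists>e\<le>n. \<exists>\<theta>\<in>deficient k m D 0 s. \<exists>\<theta>'\<in>deficient k m D e n.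
    real (card {t. t < n \<and> f t < k}) \<le> real (k * card E) + real (card {t. t < n \<and> c t \<in> D})
      + (\<Sum>t\<in>{0..<s}. gain D E (history k m \<theta> t) (c t))
      + (\<Sum>t\<in>{e..<n}. gain D E (history k m \<theta>' t) (c t))"
proof -
  \<comment> \<open>The position of chain \<open>j\<close> at time \<open>t\<close> is the highest
    piece it has used so far, or 0 before its first letter. Since chains climb weakly, this is the
    current piece whenever the chain takes a letter.\<close>
  define h where "h j t = Max (insert 0 (c ` {s. s \<le> t \<and> s < n \<and> f s = j}))" for j t
  have hmono: "h j s \<le> h j t" if "s \<le> t" for j s t
    unfolding h_def using that by (intro Max_mono) auto
  have hm: "h j t \<le> m" for j t
    unfolding h_def using c by (auto intro!: less_imp_le)
  have hc: "h (f t) t = c t" if "t < n" "f t < k" for t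
    unfolding h_def
  proof (rule Max_eqI)
    fix y assume "y \<in> insert 0 (c ` {s. s \<le> t \<and> s < n \<and> f s = f t})"
    then show "y \<le> c t" using chain[of _ t] that by (auto simp: le_less)
  qed (use that in auto)
  let ?h = "\<lambda>t. (\<lambda>j. h j t) ` {..<k}"
  let ?g = "\<lambda>t. gain D E (?h t) (c t)"
  \<comment> \<open>The time \<open>s\<close> is the first at which \<open>D\<close> is covered and
    \<open>e\<close> is one more than the last; if \<open>D\<close> is never covered, both are
    \<open>n\<close> and the second interval is empty.\<close>
  obtain s e where se: "s \<le> e" "e \<le> n" "\<And>t. t \<in> {0..<s} \<Longrightarrow> \<not> D \<subseteq> ?h t"
    "\<And>t. t \<in> {e..<n} \<Longrightarrow> \<not> D \<subseteq> ?h t" "\<And>t. t \<in> {s..<e} \<Longrightarrow> ?h t = D"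
  proof (cases "\<exists>t<n. D \<subseteq> ?h t")
    case False
    then show ?thesis by (intro that[of n n]) auto
  next
    case True
    let ?T = "{t. t < n \<and> D \<subseteq> ?h t}"
    have T: "finite ?T" "?T \<noteq> {}" using True by auto
    have mm: "Min ?T \<in> ?T" "Max ?T \<in> ?T" using T by (auto intro: Min_in Max_in simp del: mem_Collect_eq)
    show ?thesis
    proof (rule that[of "Min ?T" "Suc (Max ?T)"])
      show "Min ?T \<le> Suc (Max ?T)" using Min_le[OF T(1) mm(2)] by simp
      show "Suc (Max ?T) \<le> n" using mm(2) by simp
      show "\<not> D \<subseteq> ?h t" if "t \<in> {0..<Min ?T}" for t
      proof
        assume "D \<subseteq> ?h t"
        then have "t \<in> ?T" using that mm(1) by auto
        then have "Min ?T \<le> t" by (rule Min_le[OF T(1)])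
        then show False using that by simp
      qed
      show "\<not> D \<subseteq> ?h t" if "t \<in> {Suc (Max ?T)..<n}" for t
      proof
        assume "D \<subseteq> ?h t"
        then have "t \<in> ?T" using that by auto
        then have "t \<le> Max ?T" by (rule Max_ge[OF T(1)])
        then show False using that by simp
      qed
      show "?h t = D" if "t \<in> {Min ?T..<Suc (Max ?T)}" for t
        using mm that by (intro squeezed_covering[where s = "Min ?T" and t = t and u = "Max ?T", OF hmono D(1)]) auto
    qed
  qed
  obtain \<theta> where \<theta>: "\<theta> \<in> deficient k m D 0 s" "\<And>t. t \<in> {0..<s} \<Longrightarrow> history k m \<theta> t = ?h t"
    using deficient_exists[of h m 0 s D k, OF hmono hm _ se(3)] by auto
  obtain \<theta>' where \<theta>': "\<theta>' \<in> deficient k m D e n" "\<And>t. t \<in> {e..<n} \<Longrightarrow> history k m \<theta>' t = ?h t"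
    using deficient_exists[of h m e n D k, OF hmono hm se(2) se(4)] by auto
  \<comment> \<open>A chain meets each piece of \<open>E\<close> at most once, so a chain together
    with a piece determines the time.\<close>
  have "card {t. t < n \<and> f t < k \<and> c t \<in> E} \<le> card ({..<k} \<times> E)"
  proof (rule card_inj_on_le[where f = "\<lambda>t. (f t, c t)"])
    show "inj_on (\<lambda>t. (f t, c t)) {t. t < n \<and> f t < k \<and> c t \<in> E}"
    proof (rule inj_onI)
      fix x y assume "x \<in> {t. t < n \<and> f t < k \<and> c t \<in> E}" "y \<in> {t. t < n \<and> f t < k \<and> c t \<in> E}"
        "(f x, c x) = (f y, c y)"
      then show "x = y" using chain[of x y] chain[of y x] by (cases x y rule: linorder_cases) auto
    qed
  qed (use E in auto)
  then have cE: "card {t. t < n \<and> f t < k \<and> c t \<in> E} \<le> k * card E"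
    by (simp add: card_cartesian_product)
  have bool_card: "(\<Sum>t<n. of_bool (Q t)) = real (card {t. t < n \<and> Q t})" for Q
  proof -
    have "(\<Sum>t<n. of_bool (Q t) :: real) = (\<Sum>t\<in>{t. t < n \<and> Q t}. 1)"
      by (rule sum.mono_neutral_cong_right) auto
    then show ?thesis by simp
  qed
  have "real (card {t. t < n \<and> f t < k}) = (\<Sum>t<n. of_bool (f t < k))" by (rule bool_card[symmetric])
  \<comment> \<open>The last two terms add up to the indicator of \<open>c t\<close> lying in the
    occupied pieces outside \<open>E\<close>. A covered letter is counted either there or by the
    first term.\<close>
  also have "\<dots> \<le> (\<Sum>t<n. of_bool (f t < k \<and> c t \<in> E) + (of_bool (c t \<in> D) + ?g t))"
  proof (rule sum_mono)
    fix t assume "t \<in> {..<n}"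
    then have "f t < k \<Longrightarrow> c t \<in> ?h t" using hc[of t] by (metis imageI lessThan_iff)
    then show "(of_bool (f t < k) :: real) \<le> of_bool (f t < k \<and> c t \<in> E) + (of_bool (c t \<in> D) + ?g t)"
      by (auto simp: gain_def)
  qed
  also have "\<dots> = real (card {t. t < n \<and> f t < k \<and> c t \<in> E}) + real (card {t. t < n \<and> c t \<in> D}) + (\<Sum>t<n. ?g t)"
    by (simp add: sum.distrib bool_card)
  also have "(\<Sum>t<n. ?g t) = (\<Sum>t\<in>{0..<s}. ?g t) + (\<Sum>t\<in>{s..<e}. ?g t) + (\<Sum>t\<in>{e..<n}. ?g t)"
    using se(1,2) by (simp add: sum.atLeastLessThan_concat lessThan_atLeast0)
  also have "(\<Sum>t\<in>{s..<e}. ?g t) = 0"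
  proof (rule sum.neutral, rule ballI)
    fix t assume "t \<in> {s..<e}"
    then show "?g t = 0" using se(5)[of t] D(2) by (auto simp: gain_def)
  qed
  also have "(\<Sum>t\<in>{0..<s}. ?g t) = (\<Sum>t\<in>{0..<s}. gain D E (history k m \<theta> t) (c t))"
    using \<theta>(2) by (intro sum.cong) auto
  also have "(\<Sum>t\<in>{e..<n}. ?g t) = (\<Sum>t\<in>{e..<n}. gain D E (history k m \<theta>' t) (c t))"
    using \<theta>'(2) by (intro sum.cong) auto
  finally have "real (card {t. t < n \<and> f t < k}) \<le> real (k * card E) + real (card {t. t < n \<and> c t \<in> D})
      + (\<Sum>t\<in>{0..<s}. gain D E (history k m \<theta> t) (c t))
      + (\<Sum>t\<in>{e..<n}. gain D E (history k m \<theta>' t) (c t))"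
    using cE by (simp flip: of_nat_mult)
  moreover have "s \<le> n" using se by simp
  ultimately show ?thesis using \<theta>(1) \<theta>'(1) se(2) by blast
qed

section \<open>Exponential moments and the union bound over histories\<close>

lemma (in prob_space) nn_integral_exp_gain:
  fixes c :: "'a \<Rightarrow> nat"
  assumes c: "c \<in> measurable M (count_space UNIV)" and d: "0 < \<delta>" "\<delta> \<le> 1"
    and gap: "prob {z \<in> space M. c z \<in> H - E} \<le> prob {z \<in> space M. c z \<in> D} - \<delta>"
  shows "(\<integral>\<^sup>+ z. ennreal (exp (\<delta> / 2 * gain D E H (c z))) \<partial>M) \<le> ennreal (1 - \<delta>\<^sup>2 / 4)"
proof -
  \<comment> \<open>The inequality \<open>exp x \<le> 1 + x + x\<^sup>2\<close> bounds the mean by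
    \<open>1 - \<tau> * \<delta> + \<tau>\<^sup>2\<close>, and \<open>\<delta> / 2\<close> minimises
    this expression.\<close>
  define \<tau> where "\<tau> = \<delta> / 2"
  define A where "A = {z \<in> space M. c z \<in> H - E}"
  define B where "B = {z \<in> space M. c z \<in> D}"
  have A: "A \<in> sets M" and B: "B \<in> sets M"
    unfolding A_def B_def using c by measurable
  have t: "0 < \<tau>" "\<tau> \<le> 1" using d by (auto simp: \<tau>_def)
  have "(\<integral>\<^sup>+ z. ennreal (exp (\<tau> * gain D E H (c z))) \<partial>M)
      \<le> (\<integral>\<^sup>+ z. ennreal (1 + \<tau> * (indicator A z - indicator B z) + \<tau>\<^sup>2) \<partial>M)"
  proof (intro nn_integral_mono ennreal_leI)
    fix z assume z: "z \<in> space M"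
    have g: "gain D E H (c z) = indicator A z - indicator B z"
      using z by (auto simp: gain_def A_def B_def indicator_def)
    have b: "\<bar>indicator A z - indicator B z :: real\<bar> \<le> 1" by (auto simp: indicator_def)
    then have "\<bar>\<tau> * (indicator A z - indicator B z)\<bar> \<le> 1 * 1"
      unfolding abs_mult using t by (intro mult_mono) auto
    moreover have le: "exp x \<le> 1 + x + x\<^sup>2" if "\<bar>x\<bar> \<le> 1" for x :: real
    proof (cases "0 \<le> x")
      case True
      then show ?thesis using exp_bound[of x] that by simp
    next
      case False
      have "1 \<le> (1 + (-x)) * (1 + x + x\<^sup>2)"
      proof -
        have "(1 + (-x)) * (1 + x + x\<^sup>2) = 1 - x ^ 3" by (simp add: algebra_simps power2_eq_square power3_eq_cube)
        moreover have "x ^ 3 \<le> 0" using False by (simp add: power_le_zero_eq)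
        ultimately show ?thesis by simp
      qed
      also have "\<dots> \<le> exp (- x) * (1 + x + x\<^sup>2)"
      proof (rule mult_right_mono)
        show "1 + - x \<le> exp (- x)" by (rule exp_ge_add_one_self)
        have "0 \<le> 1 + x" using that by simp
        then show "0 \<le> 1 + x + x\<^sup>2" by simp
      qed
      finally show ?thesis by (simp add: exp_minus field_simps)
    qed
    ultimately have "exp (\<tau> * (indicator A z - indicator B z))
        \<le> 1 + \<tau> * (indicator A z - indicator B z) + (\<tau> * (indicator A z - indicator B z))\<^sup>2"
      by (intro le) simp
    also have "(\<tau> * (indicator A z - indicator B z))\<^sup>2 \<le> \<tau>\<^sup>2"
      by (auto simp: indicator_def power2_eq_square)
    finally show "exp (\<tau> * gain D E H (c z)) \<le> 1 + \<tau> * (indicator A z - indicator B z) + \<tau>\<^sup>2"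
      unfolding g by simp
  qed
  also have "\<dots> = ennreal (\<integral> z. 1 + \<tau> * (indicator A z - indicator B z) + \<tau>\<^sup>2 \<partial>M)"
  proof (rule nn_integral_eq_integral)
    show "integrable M (\<lambda>z. 1 + \<tau> * (indicator A z - indicator B z) + \<tau>\<^sup>2)"
      using A B by (intro Bochner_Integration.integrable_add integrable_mult_right
        Bochner_Integration.integrable_diff integrable_real_indicator) (auto simp: emeasure_eq_measure)
    show "AE z in M. 0 \<le> 1 + \<tau> * (indicator A z - indicator B z) + \<tau>\<^sup>2"
      using t by (intro AE_I2) (auto simp: indicator_def)
  qed
  also have "(\<integral> z. 1 + \<tau> * (indicator A z - indicator B z) + \<tau>\<^sup>2 \<partial>M) = 1 + \<tau> * (prob A - prob B) + \<tau>\<^sup>2"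
    using A B by (simp add: prob_space emeasure_eq_measure)
  also have "\<dots> \<le> 1 + \<tau> * (- \<delta>) + \<tau>\<^sup>2"
    using gap t mult_left_mono[of "prob A - prob B" "- \<delta>" \<tau>] by (simp add: A_def B_def)
  also have "\<dots> = 1 - \<delta>\<^sup>2 / 4" by (simp add: \<tau>_def field_simps power2_eq_square)
  finally show ?thesis unfolding \<tau>_def by (simp add: ennreal_leI)
qed

text \<open>A geometric sequence with a ratio strictly between \<rho> and 1 absorbs the polynomial
  factor.\<close>

lemma summable_poly_geometric:
  fixes \<rho> :: real
  assumes "0 \<le> \<rho>" "\<rho> < 1"
  shows "summable (\<lambda>l. real ((l + 1) ^ N) * \<rho> ^ l)"
proof (cases "\<rho> = 0")
  case True
  then have "(\<lambda>l. real ((l + 1) ^ N) * \<rho> ^ l) = (\<lambda>l. if l = 0 then 1 else 0)"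
    by (auto simp: power_0_left)
  then show ?thesis by simp
next
  case False
  define r where "r = (1 + \<rho>) / 2"
  have r: "\<rho> < r" "0 < r" "r < 1" using assms by (auto simp: r_def)
  have "(\<lambda>l. real ((l + 1) ^ N) * \<rho> ^ l) \<in> O(\<lambda>l. r ^ l)"
    using r assms False by real_asymp
  moreover have "summable (\<lambda>l. norm (r ^ l))" using r by simp
  ultimately show ?thesis by (rule summable_comparison_test_bigo[rotated])
qed

text \<open>The sets \<open>H t\<close> are fixed in advance and do not depend on the word, so the
  exponential is a product of functions of independent letters.\<close>

lemma (in prob_space) nn_integral_exp_history:
  fixes c :: "'a \<Rightarrow> nat"
  assumes c: "c \<in> measurable M (count_space UNIV)" and d: "0 < \<delta>" "\<delta> \<le> 1"
    and gap: "\<And>t. t \<in> {a..<b} \<Longrightarrow> prob {z \<in> space M. c z \<in> H t - E} \<le> prob {z \<in> space M. c z \<in> D} - \<delta>"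
    and ab: "a \<le> b" "b \<le> n"
  shows "(\<integral>\<^sup>+ w. ennreal (exp (\<delta> / 2 * (\<Sum>t\<in>{a..<b}. gain D E (H t) (c (w t))))) \<partial>PiM {..<n} (\<lambda>_. M))
    \<le> ennreal ((1 - \<delta>\<^sup>2 / 4) ^ (b - a))"
proof -
  interpret P: product_prob_space "\<lambda>_::nat. M" "{..<n}" ..
  \<comment> \<open>The factor 1 outside the interval turns the product into one over all
    coordinates of the product space.\<close>
  define \<phi> where "\<phi> t z = (if t \<in> {a..<b} then ennreal (exp (\<delta> / 2 * gain D E (H t) (c z))) else 1)" for t z
  have gm: "(\<lambda>z. exp (\<delta> / 2 * gain D E (H t) (c z))) \<in> borel_measurable M" for t
    by (rule measurable_compose[OF c]) simp
  have \<phi>m: "\<phi> t \<in> borel_measurable M" for t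
    unfolding \<phi>_def using gm by (cases "t \<in> {a..<b}") auto
  have split: "(\<Prod>t\<in>{..<n}. if t \<in> {a..<b} then F t else 1) = (\<Prod>t\<in>{a..<b}. F t)" for F :: "nat \<Rightarrow> ennreal"
    by (rule prod.mono_neutral_cong_right) (use ab in auto)
  have "ennreal (exp (\<delta> / 2 * (\<Sum>t\<in>{a..<b}. gain D E (H t) (c (w t))))) = (\<Prod>t\<in>{..<n}. \<phi> t (w t))" for w
    unfolding \<phi>_def split sum_distrib_left exp_sum[OF finite_atLeastLessThan] by (rule prod_ennreal[symmetric]) simp
  then have "(\<integral>\<^sup>+ w. ennreal (exp (\<delta> / 2 * (\<Sum>t\<in>{a..<b}. gain D E (H t) (c (w t))))) \<partial>PiM {..<n} (\<lambda>_. M))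
      = (\<Prod>t\<in>{..<n}. \<integral>\<^sup>+ z. \<phi> t z \<partial>M)"
    using P.product_nn_integral_prod[of "{..<n}" \<phi>] \<phi>m by simp
  also have "\<dots> = (\<Prod>t\<in>{..<n}. if t \<in> {a..<b} then \<integral>\<^sup>+ z. ennreal (exp (\<delta> / 2 * gain D E (H t) (c z))) \<partial>M else 1)"
    by (intro prod.cong refl) (auto simp: \<phi>_def emeasure_space_1)
  also have "\<dots> \<le> (\<Prod>t\<in>{a..<b}. ennreal (1 - \<delta>\<^sup>2 / 4))"
    unfolding split by (intro prod_mono_ennreal nn_integral_exp_gain c d gap)
  also have "\<dots> = ennreal ((1 - \<delta>\<^sup>2 / 4) ^ (b - a))"
    using d power_le_one[of \<delta> 2] by (simp add: ennreal_power)
  finally show ?thesis .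
qed

text \<open>The excess enters only through a measurable majorant \<open>g\<close>, which has to
  serve for all words and all colourings simultaneously.\<close>

definition chains_bounded ::
  "'a measure \<Rightarrow> ('a \<Rightarrow> 'a \<Rightarrow> bool) \<Rightarrow> 'a set \<Rightarrow> nat \<Rightarrow> real \<Rightarrow> nat \<Rightarrow> ((nat \<Rightarrow> 'a) \<Rightarrow> real) \<Rightarrow> bool" where
  "chains_bounded M Q B k C n g \<longleftrightarrow>
     g \<in> borel_measurable (PiM {..<n} (\<lambda>_. M)) \<and> (\<forall>w. 0 \<le> g w) \<and>
     (\<integral>\<^sup>+ w. ennreal (g w) \<partial>PiM {..<n} (\<lambda>_. M)) \<le> ennreal C \<and>
     (\<forall>w f. (\<forall>s t. s < t \<longrightarrow> t < n \<longrightarrow> f s = f t \<longrightarrow> f s < k \<longrightarrow> Q (w s) (w t)) \<longrightarrow>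
        real (card {t. t < n \<and> f t < k}) \<le> real (card {t. t < n \<and> w t \<in> B}) + g w)"

text \<open>The actual histories and cut points depend on the word, so exponentials are summed over
  all deficient histories and all possible cut points. An interval of length \<open>l\<close>
  contributes at most \<open>(l + 1) ^ (k * m) * \<rho> ^ l\<close> to the mean, and these bounds
  are summable over \<open>l\<close>.\<close>

theorem (in prob_space) chains_excess_expectation:
  fixes c :: "'a \<Rightarrow> nat"
  assumes c: "c \<in> measurable M (count_space UNIV)" "\<And>z. c z < m"
    and d: "0 < \<delta>" "\<delta> \<le> 1"
    and D: "card D = k" "D \<inter> E = {}" and E: "finite E"
    and gap: "\<And>H. finite H \<Longrightarrow> card H \<le> k \<Longrightarrow> \<not> D \<subseteq> H \<Longrightarrow>
       prob {z \<in> space M. c z \<in> H - E} \<le> prob {z \<in> space M. c z \<in> D} - \<delta>"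
  shows "\<exists>C\<ge>0. \<forall>n. \<exists>g. chains_bounded M (\<lambda>x y. c x \<le> c y \<and> (c x = c y \<longrightarrow> c x \<notin> E)) {z. c z \<in> D} k C n g"
proof -
  define \<rho> where "\<rho> = 1 - \<delta>\<^sup>2 / 4"
  have \<rho>: "0 \<le> \<rho>" "\<rho> < 1" using d power_le_one[of \<delta> 2] by (auto simp: \<rho>_def)
  define B where "B = (\<Sum>l. real ((l + 1) ^ (k * m)) * \<rho> ^ l)"
  have sm: "summable (\<lambda>l. real ((l + 1) ^ (k * m)) * \<rho> ^ l)"
    by (rule summable_poly_geometric[OF \<rho>])
  have B0: "0 \<le> B" unfolding B_def by (rule suminf_nonneg[OF sm]) (use \<rho> in simp)
  define W where "W \<theta> a b w = exp (\<delta> / 2 * (\<Sum>t\<in>{a..<b}. gain D E (history k m \<theta> t) (c (w t))))" for \<theta> a b and w :: "nat \<Rightarrow> 'a"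
  define Z where "Z a b w = (\<Sum>\<theta>\<in>deficient k m D a b. W \<theta> a b w)" for a b w
  have W0: "0 \<le> W \<theta> a b w" for \<theta> a b w by (simp add: W_def)
  have Z0: "0 \<le> Z a b w" for a b w unfolding Z_def by (intro sum_nonneg W0)
  have Wm: "W \<theta> a b \<in> borel_measurable (PiM {..<n} (\<lambda>_. M))" if "b \<le> n" for \<theta> a b n
  proof -
    have "(\<lambda>w. gain D E (history k m \<theta> t) (c (w t))) \<in> borel_measurable (PiM {..<n} (\<lambda>_. M))" if "t \<in> {a..<b}" for t
    proof (rule measurable_compose[of "\<lambda>w. w t" _ M])
      show "(\<lambda>w. w t) \<in> measurable (PiM {..<n} (\<lambda>_. M)) M"
        using that \<open>b \<le> n\<close> by (intro measurable_component_singleton) auto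
      show "(\<lambda>z. gain D E (history k m \<theta> t) (c z)) \<in> borel_measurable M"
        by (rule measurable_compose[OF c(1)]) simp
    qed
    then show ?thesis unfolding W_def
      by (intro borel_measurable_exp[THEN measurable_compose[rotated]] borel_measurable_times borel_measurable_sum) auto
  qed
  have Zm: "Z a b \<in> borel_measurable (PiM {..<n} (\<lambda>_. M))" if "b \<le> n" for a b n
    unfolding Z_def using Wm[OF that] by (intro borel_measurable_sum) auto
  have Zint: "(\<integral>\<^sup>+ w. ennreal (Z a b w) \<partial>PiM {..<n} (\<lambda>_. M)) \<le> ennreal (real ((b - a + 1) ^ (k * m)) * \<rho> ^ (b - a))"
    if ab: "a \<le> b" "b \<le> n" for a b n
  proof -
    have "(\<integral>\<^sup>+ w. ennreal (Z a b w) \<partial>PiM {..<n} (\<lambda>_. M))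
        = (\<integral>\<^sup>+ w. (\<Sum>\<theta>\<in>deficient k m D a b. ennreal (W \<theta> a b w)) \<partial>PiM {..<n} (\<lambda>_. M))"
      unfolding Z_def using W0 by simp
    also have "\<dots> = (\<Sum>\<theta>\<in>deficient k m D a b. \<integral>\<^sup>+ w. ennreal (W \<theta> a b w) \<partial>PiM {..<n} (\<lambda>_. M))"
      using Wm[OF ab(2)] by (intro nn_integral_sum) auto
    also have "\<dots> \<le> (\<Sum>\<theta>\<in>deficient k m D a b. ennreal (\<rho> ^ (b - a)))"
    proof (rule sum_mono)
      fix \<theta> assume \<theta>: "\<theta> \<in> deficient k m D a b"
      show "(\<integral>\<^sup>+ w. ennreal (W \<theta> a b w) \<partial>PiM {..<n} (\<lambda>_. M)) \<le> ennreal (\<rho> ^ (b - a))"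
        unfolding W_def \<rho>_def
      proof (rule nn_integral_exp_history[OF c(1) d _ ab])
        fix t assume t: "t \<in> {a..<b}"
        have "finite (history k m \<theta> t)" "card (history k m \<theta> t) \<le> k"
          unfolding history_def using card_image_le[of "{..<k}"] by fastforce+
        moreover have "\<not> D \<subseteq> history k m \<theta> t" using \<theta> t by (auto simp: deficient_def)
        ultimately show "prob {z \<in> space M. c z \<in> history k m \<theta> t - E} \<le> prob {z \<in> space M. c z \<in> D} - \<delta>"
          by (rule gap)
      qed
    qed
    also have "\<dots> = ennreal (real (card (deficient k m D a b)) * \<rho> ^ (b - a))"
      using \<rho> by (simp add: ennreal_mult ennreal_of_nat_eq_real_of_nat)
    also have "\<dots> \<le> ennreal (real ((b - a + 1) ^ (k * m)) * \<rho> ^ (b - a))"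
      using card_deficient[OF ab(1), of k m D] \<rho> by (intro ennreal_leI mult_right_mono) (auto simp flip: of_nat_power)
    finally show ?thesis .
  qed
  \<comment> \<open>The constant accounts for the pieces of \<open>E\<close>, and the factor
    \<open>2 / \<delta>\<close> comes from \<open>x \<le> exp x\<close> applied to
    \<open>\<delta> / 2\<close> times the total gain.\<close>
  define g where "g n w = real (k * card E) + 2 / \<delta> * ((\<Sum>s\<le>n. Z 0 s w) + (\<Sum>e\<le>n. Z e n w))" for n w
  have gm: "g n \<in> borel_measurable (PiM {..<n} (\<lambda>_. M))" for n
    unfolding g_def using Zm[of _ n] by (intro borel_measurable_add borel_measurable_times borel_measurable_sum) auto
  have g0: "0 \<le> g n w" for n w
    unfolding g_def using d by (intro add_nonneg_nonneg mult_nonneg_nonneg sum_nonneg Z0) auto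
  have geo: "(\<Sum>l\<le>n. real ((l + 1) ^ (k * m)) * \<rho> ^ l) \<le> B" for n
    unfolding B_def by (rule sum_le_suminf[OF sm]) (use \<rho> in auto)
  have gint: "(\<integral>\<^sup>+ w. ennreal (g n w) \<partial>PiM {..<n} (\<lambda>_. M)) \<le> ennreal (real (k * card E) + 2 / \<delta> * (B + B))" for n
  proof -
    interpret P: product_prob_space "\<lambda>_::nat. M" "{..<n}" ..
    let ?P = "PiM {..<n} (\<lambda>_. M)"
    have s1: "(\<integral>\<^sup>+ w. ennreal (\<Sum>s\<le>n. Z 0 s w) \<partial>?P) \<le> ennreal B"
    proof -
      have "(\<integral>\<^sup>+ w. ennreal (\<Sum>s\<le>n. Z 0 s w) \<partial>?P) = (\<Sum>s\<le>n. \<integral>\<^sup>+ w. ennreal (Z 0 s w) \<partial>?P)"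
        using Zm[of _ n] Z0 by (subst nn_integral_sum[symmetric]) auto
      also have "\<dots> \<le> (\<Sum>s\<le>n. ennreal (real ((s + 1) ^ (k * m)) * \<rho> ^ s))"
        using Zint[of 0 _ n] by (intro sum_mono) auto
      also have "\<dots> \<le> ennreal B" using geo[of n] \<rho> by (subst sum_ennreal) (auto intro: ennreal_leI)
      finally show ?thesis .
    qed
    have s2: "(\<integral>\<^sup>+ w. ennreal (\<Sum>e\<le>n. Z e n w) \<partial>?P) \<le> ennreal B"
    proof -
      have "(\<integral>\<^sup>+ w. ennreal (\<Sum>e\<le>n. Z e n w) \<partial>?P) = (\<Sum>e\<le>n. \<integral>\<^sup>+ w. ennreal (Z e n w) \<partial>?P)"
        using Zm[of n n] Z0 by (subst nn_integral_sum[symmetric]) auto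
      also have "\<dots> \<le> (\<Sum>e\<le>n. ennreal (real ((n - e + 1) ^ (k * m)) * \<rho> ^ (n - e)))"
        using Zint[of _ n n] by (intro sum_mono) auto
      also have "\<dots> = (\<Sum>l\<le>n. ennreal (real ((l + 1) ^ (k * m)) * \<rho> ^ l))"
        by (rule sum.reindex_bij_witness[of _ "\<lambda>l. n - l" "\<lambda>e. n - e"]) auto
      also have "\<dots> \<le> ennreal B" using geo[of n] \<rho> by (subst sum_ennreal) (auto intro: ennreal_leI)
      finally show ?thesis .
    qed
    have split: "ennreal (u + v * (x + y)) = ennreal u + ennreal v * (ennreal x + ennreal y)"
      if "0 \<le> u" "0 \<le> v" "0 \<le> x" "0 \<le> y" for u v x y :: real
      using that by (simp add: ennreal_mult)
    have "(\<integral>\<^sup>+ w. ennreal (g n w) \<partial>?P) = (\<integral>\<^sup>+ w. ennreal (real (k * card E)) + ennreal (2 / \<delta>) *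
        (ennreal (\<Sum>s\<le>n. Z 0 s w) + ennreal (\<Sum>e\<le>n. Z e n w)) \<partial>?P)"
      unfolding g_def using d
      by (intro nn_integral_cong split sum_nonneg Z0) auto
    also have "\<dots> = ennreal (real (k * card E)) + ennreal (2 / \<delta>) *
        ((\<integral>\<^sup>+ w. ennreal (\<Sum>s\<le>n. Z 0 s w) \<partial>?P) + (\<integral>\<^sup>+ w. ennreal (\<Sum>e\<le>n. Z e n w) \<partial>?P))"
      using Zm[of _ n]
      by (simp add: nn_integral_add nn_integral_cmult P.emeasure_space_1 del: sum_ennreal)
    also have "\<dots> \<le> ennreal (real (k * card E)) + ennreal (2 / \<delta>) * (ennreal B + ennreal B)"
      by (intro add_mono mult_left_mono s1 s2) auto
    also have "\<dots> = ennreal (real (k * card E) + 2 / \<delta> * (B + B))"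
      using B0 d by (intro split[symmetric]) auto
    finally show ?thesis .
  qed
  have bound: "real (card {t. t < n \<and> f t < k}) \<le> real (card {t. t < n \<and> c (w t) \<in> D}) + g n w"
    if "\<And>a b. a < b \<Longrightarrow> b < n \<Longrightarrow> f a = f b \<Longrightarrow> f a < k \<Longrightarrow>
           c (w a) \<le> c (w b) \<and> (c (w a) = c (w b) \<longrightarrow> c (w a) \<notin> E)" for n w and f :: "nat \<Rightarrow> nat"
  proof -
    have le: "(\<Sum>t\<in>{a..<b}. gain D E (history k m \<theta> t) (c (w t))) \<le> 2 / \<delta> * Z a b w"
      if "\<theta> \<in> deficient k m D a b" for \<theta> a b
    proof -
      let ?x = "\<Sum>t\<in>{a..<b}. gain D E (history k m \<theta> t) (c (w t))"
      have exp_ge: "x \<le> exp x" for x :: real using exp_ge_add_one_self[of x] by linarith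
      have "\<delta> / 2 * ?x \<le> W \<theta> a b w"
        unfolding W_def by (rule exp_ge)
      also have "\<dots> \<le> Z a b w" unfolding Z_def
        using that by (intro member_le_sum finite_deficient W0)
      finally show ?thesis using d by (simp add: field_simps)
    qed
    from chains_excess[of n "\<lambda>t. c (w t)" m f k E D, OF c(2) that D E]
    obtain s e \<theta> \<theta>' where se: "s \<le> n" "e \<le> n" "\<theta> \<in> deficient k m D 0 s" "\<theta>' \<in> deficient k m D e n"
      and le': "real (card {t. t < n \<and> f t < k}) \<le> real (k * card E) + real (card {t. t < n \<and> c (w t) \<in> D})
      + (\<Sum>t\<in>{0..<s}. gain D E (history k m \<theta> t) (c (w t)))
      + (\<Sum>t\<in>{e..<n}. gain D E (history k m \<theta>' t) (c (w t)))" by blast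
    have "2 / \<delta> * Z 0 s w \<le> 2 / \<delta> * (\<Sum>s\<le>n. Z 0 s w)"
      using se(1) d by (intro mult_left_mono member_le_sum Z0) auto
    moreover have "2 / \<delta> * Z e n w \<le> 2 / \<delta> * (\<Sum>e\<le>n. Z e n w)"
      using se(2) d by (intro mult_left_mono member_le_sum[of e _ "\<lambda>e. Z e n w"] Z0) auto
    ultimately show ?thesis
      using le'[unfolded] le[OF se(3)] le[OF se(4)] unfolding g_def distrib_left by linarith
  qed
  show ?thesis
  proof (intro exI[of _ "real (k * card E) + 2 / \<delta> * (B + B)"] conjI allI)
    show "0 \<le> real (k * card E) + 2 / \<delta> * (B + B)" using B0 d by simp
    show "\<exists>g. chains_bounded M (\<lambda>x y. c x \<le> c y \<and> (c x = c y \<longrightarrow> c x \<notin> E)) {z. c z \<in> D} k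
       (real (k * card E) + 2 / \<delta> * (B + B)) n g" for n
      unfolding chains_bounded_def mem_Collect_eq
      by (intro exI[of _ "g n"] conjI allI impI gm g0 gint bound) auto
  qed
qed

lemma chains_bounded_mono:
  assumes "chains_bounded M Q B k C n g" "\<And>x y. Q' x y \<Longrightarrow> Q x y"
  shows "chains_bounded M Q' B k C n g"
  using assms unfolding chains_bounded_def by (meson order.refl)

section \<open>The alphabet and its measure\<close>

lemma sigma_algebra_letter_sets: "sigma_algebra UNIV letter_sets"
  unfolding sigma_algebra_iff2
proof (intro conjI ballI allI impI)
  show "UNIV - A \<in> letter_sets" if "A \<in> letter_sets" for A
  proof -
    have "{r. G r \<in> UNIV - A} = space borel - {r. G r \<in> A}" by auto
    then show ?thesis using that unfolding letter_sets_def by (simp del: Compl_eq_Diff_UNIV)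
  qed
  show "\<Union>(range A) \<in> letter_sets" if "range A \<subseteq> letter_sets" for A :: "nat \<Rightarrow> letter set"
  proof -
    have "{r. G r \<in> \<Union>(range A)} = (\<Union>n. {r. G r \<in> A n})" by auto
    moreover have "{r. G r \<in> A n} \<in> sets borel" for n using that unfolding letter_sets_def by auto
    ultimately show ?thesis unfolding letter_sets_def by auto
  qed
qed (auto simp: letter_sets_def)

lemma space_mu1 [simp]: "space (mu1 \<alpha> \<beta> \<gamma>) = UNIV"
  unfolding mu1_def by (rule space_measure_of) auto

lemma sets_mu1 [simp]: "sets (mu1 \<alpha> \<beta> \<gamma>) = letter_sets"
  unfolding mu1_def using sigma_algebra.sigma_sets_eq[OF sigma_algebra_letter_sets] by simp

text \<open>Written as a measure with a density, the atomic part of \<open>mu1\<close> inherits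
  countable additivity.\<close>

lemma suminf_indicator_eq_emeasure:
  "(\<Sum>i. ennreal (a i) * indicator A (h i)) =
     emeasure (density (count_space UNIV) (\<lambda>i::nat. ennreal (a i))) (h -` A)"
  by (simp add: emeasure_density nn_integral_count_space_nat indicator_vimage)

lemma emeasure_mu1:
  assumes "A \<in> letter_sets"
  shows "emeasure (mu1 \<alpha> \<beta> \<gamma>) A = (\<Sum>i. ennreal (\<alpha> (Suc i)) * indicator A (X (Suc i)))
         + (\<Sum>j. ennreal (\<beta> (Suc j)) * indicator A (Y (Suc j)))
         + ennreal \<gamma> * emeasure lborel ({0..1} \<inter> {r. G r \<in> A})" (is "_ = ?F A")
  unfolding mu1_def
proof (rule emeasure_measure_of_sigma[OF sigma_algebra_letter_sets])
  show "positive letter_sets ?F" by (simp add: positive_def)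
  show "countably_additive letter_sets ?F"
  proof (rule countably_additiveI)
    fix A :: "nat \<Rightarrow> letter set"
    assume A: "range A \<subseteq> letter_sets" "disjoint_family A"
    have disj: "disjoint_family (\<lambda>n. h -` A n)" for h :: "'b \<Rightarrow> letter"
      using A(2) by (auto simp: disjoint_family_on_def)
    have 1: "(\<Sum>n. \<Sum>i. ennreal (a i) * indicator (A n) (h i)) = (\<Sum>i. ennreal (a i) * indicator (\<Union>(range A)) (h i))"
      for a :: "nat \<Rightarrow> real" and h
      unfolding suminf_indicator_eq_emeasure vimage_UN
      by (rule suminf_emeasure) (auto intro: disj)
    have "(\<Sum>n. emeasure lborel ({0..1} \<inter> {r. G r \<in> A n})) = emeasure lborel (\<Union>n. {0..1} \<inter> {r. G r \<in> A n})"
    proof (rule suminf_emeasure)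
      show "range (\<lambda>n. {0..1} \<inter> {r. G r \<in> A n}) \<subseteq> sets lborel"
        using A(1) by (auto simp: letter_sets_def)
      show "disjoint_family (\<lambda>n. {0..1} \<inter> {r. G r \<in> A n})"
        using A(2) by (auto simp: disjoint_family_on_def)
    qed
    also have "(\<Union>n. {0..1} \<inter> {r. G r \<in> A n}) = {0..1} \<inter> {r. G r \<in> \<Union>(range A)}" by auto
    finally have "(\<Sum>n. ennreal \<gamma> * emeasure lborel ({0..1} \<inter> {r. G r \<in> A n})) =
        ennreal \<gamma> * emeasure lborel ({0..1} \<inter> {r. G r \<in> \<Union>(range A)})"
      by simp
    then show "(\<Sum>n. ?F (A n)) = ?F (\<Union>(range A))"
      by (simp only: suminf_add[symmetric, OF summableI summableI] 1)
  qed
qed (use assms in auto)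

lemma thoma_nonneg:
  assumes "thoma_params \<alpha> \<beta> \<gamma>" "1 \<le> i"
  shows "0 \<le> \<alpha> i" "0 \<le> \<beta> i" "\<alpha> (Suc i) \<le> \<alpha> i" "\<beta> (Suc i) \<le> \<beta> i" "0 \<le> \<gamma>"
  using assms unfolding thoma_params_def by (cases i; cases "i = 1"; force)+

lemma thoma_antimono:
  assumes "thoma_params \<alpha> \<beta> \<gamma>" "1 \<le> i" "i \<le> j"
  shows "\<alpha> j \<le> \<alpha> i" "\<beta> j \<le> \<beta> i"
proof -
  have "\<alpha> j \<le> \<alpha> i \<and> \<beta> j \<le> \<beta> i"
    using assms(3)
  proof (induction rule: dec_induct)
    case (step n)
    then show ?case using thoma_nonneg(3,4)[OF assms(1), of n] assms(2) by simp
  qed simp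
  then show "\<alpha> j \<le> \<alpha> i" "\<beta> j \<le> \<beta> i" by auto
qed

lemma thoma_summable:
  assumes "thoma_params \<alpha> \<beta> \<gamma>"
  shows "summable (\<lambda>i. \<alpha> (Suc i))" "summable (\<lambda>i. \<beta> (Suc i))"
proof -
  have s: "summable (\<lambda>i. \<alpha> (Suc i) + \<beta> (Suc i))" using assms by (simp add: thoma_params_def)
  show "summable (\<lambda>i. \<alpha> (Suc i))"
    by (rule summable_comparison_test[OF _ s]) (use thoma_nonneg[OF assms] in \<open>auto intro!: exI[of _ 0]\<close>)
  show "summable (\<lambda>i. \<beta> (Suc i))"
    by (rule summable_comparison_test[OF _ s]) (use thoma_nonneg[OF assms] in \<open>auto intro!: exI[of _ 0]\<close>)
qed

lemma prob_space_mu1: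
  assumes "thoma_params \<alpha> \<beta> \<gamma>"
  shows "prob_space (mu1 \<alpha> \<beta> \<gamma>)"
proof (rule prob_spaceI)
  note s = thoma_summable[OF assms]
  have "UNIV \<in> letter_sets" by (simp add: letter_sets_def)
  then have "emeasure (mu1 \<alpha> \<beta> \<gamma>) UNIV = (\<Sum>i. ennreal (\<alpha> (Suc i))) + (\<Sum>i. ennreal (\<beta> (Suc i))) + ennreal \<gamma>"
    by (simp add: emeasure_mu1)
  also have "\<dots> = ennreal (\<Sum>i. \<alpha> (Suc i)) + ennreal (\<Sum>i. \<beta> (Suc i)) + ennreal \<gamma>"
    using s thoma_nonneg[OF assms] by (simp add: suminf_ennreal2)
  also have "\<dots> = ennreal ((\<Sum>i. \<alpha> (Suc i)) + (\<Sum>i. \<beta> (Suc i)) + \<gamma>)"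
    using suminf_nonneg[OF s(1)] suminf_nonneg[OF s(2)] thoma_nonneg[OF assms]
      thoma_nonneg(5)[OF assms order.refl] by (simp flip: ennreal_plus)
  also have "(\<Sum>i. \<alpha> (Suc i)) + (\<Sum>i. \<beta> (Suc i)) + \<gamma> = 1"
    using assms s by (simp add: thoma_params_def suminf_add)
  finally show "emeasure (mu1 \<alpha> \<beta> \<gamma>) (space (mu1 \<alpha> \<beta> \<gamma>)) = 1" by simp
qed

lemma singleton_letter_sets: "{a} \<in> letter_sets"
  by (cases a) (auto simp: letter_sets_def)

lemma measure_mu1_singleton:
  assumes "thoma_params \<alpha> \<beta> \<gamma>"
  shows "1 \<le> i \<Longrightarrow> measure (mu1 \<alpha> \<beta> \<gamma>) {X i} = \<alpha> i" "1 \<le> i \<Longrightarrow> measure (mu1 \<alpha> \<beta> \<gamma>) {Y i} = \<beta> i"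
    "measure (mu1 \<alpha> \<beta> \<gamma>) {G r} = 0"
proof -
  have single: "enn2real (\<Sum>j. ennreal (a (Suc j)) * indicator {Suc j} i) = a i" if "1 \<le> i" "0 \<le> a i" for a :: "nat \<Rightarrow> real" and i
  proof -
    have "(\<Sum>j. ennreal (a (Suc j)) * indicator {Suc j} i) = (\<Sum>j\<in>{i - 1}. ennreal (a (Suc j)) * indicator {Suc j} i)"
      using that by (intro suminf_finite) (auto simp: indicator_def)
    then show ?thesis using that by simp
  qed
  have ind: "indicator {X i} (X j) = (indicator {j} i :: ennreal)" "indicator {Y i} (Y j) = (indicator {j} i :: ennreal)"
    "indicator {X i} (Y j) = (0 :: ennreal)" "indicator {Y i} (X j) = (0 :: ennreal)"
    "indicator {G r} (X j) = (0 :: ennreal)" "indicator {G r} (Y j) = (0 :: ennreal)" for i j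
    by (auto simp: indicator_def)
  show "measure (mu1 \<alpha> \<beta> \<gamma>) {X i} = \<alpha> i" if "1 \<le> i"
    using thoma_nonneg[OF assms that] by (simp add: measure_def emeasure_mu1 singleton_letter_sets ind single[OF that])
  show "measure (mu1 \<alpha> \<beta> \<gamma>) {Y i} = \<beta> i" if "1 \<le> i"
    using thoma_nonneg[OF assms that] by (simp add: measure_def emeasure_mu1 singleton_letter_sets ind single[OF that])
  have "emeasure lborel ({0..1} \<inter> {r'. r' = r}) \<le> emeasure lborel {r}" by (intro emeasure_mono) auto
  then show "measure (mu1 \<alpha> \<beta> \<gamma>) {G r} = 0"
    by (simp add: measure_def emeasure_mu1 singleton_letter_sets ind)
qed

lemma AE_Alph: "AE z in mu1 \<alpha> \<beta> \<gamma>. z \<in> Alph"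
proof (rule AE_I)
  have "{r. G r \<in> - Alph} = - {0..1}" by (auto simp: Alph_def G_set_def Le_set_def Lo_set_def)
  then have s: "- Alph \<in> letter_sets" by (simp add: letter_sets_def)
  have "X (Suc i) \<in> Alph" "Y (Suc i) \<in> Alph" for i by (auto simp: Alph_def Le_set_def Lo_set_def)
  moreover have "{0..1} \<inter> {r. G r \<in> - Alph} = {}" by (auto simp: Alph_def G_set_def)
  ultimately show "emeasure (mu1 \<alpha> \<beta> \<gamma>) (- Alph) = 0" by (simp only: emeasure_mu1[OF s]) simp
  show "- Alph \<in> sets (mu1 \<alpha> \<beta> \<gamma>)" using s by simp
qed auto

text \<open>The summands count the marked letters up to \<open>z\<close> and strictly below \<open>z\<close>; this separates each
  marked letter from both of its neighbouring gaps.\<close>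

definition coarse :: "letter rel \<Rightarrow> letter set \<Rightarrow> letter \<Rightarrow> nat" where
  "coarse q A z = card {a \<in> A. (a, z) \<in> q} + card {a \<in> A. (a, z) \<in> q \<and> a \<noteq> z}"

lemma coarse_mono:
  assumes "linear_order_on Alph q" "finite A" "(z, z') \<in> q"
  shows "coarse q A z \<le> coarse q A z'"
proof -
  have "trans q" "antisym q" using assms(1) by (auto simp: order_on_defs)
  then show ?thesis unfolding coarse_def using assms(2,3)
    by (intro add_mono card_mono) (auto dest: transD antisymD)
qed

lemma coarse_less: "finite A \<Longrightarrow> coarse q A z < 2 * card A + 1"
  unfolding coarse_def using card_mono[of A "{a \<in> A. (a, z) \<in> q}"] card_mono[of A "{a \<in> A. (a, z) \<in> q \<and> a \<noteq> z}"]
  by fastforce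

text \<open>If \<open>z\<close> lies below the marked letter \<open>a\<close>, then \<open>a\<close>
  itself is missing from the first summand of \<open>z\<close>; if \<open>z\<close> lies above, then
  \<open>a\<close> is an additional element in its second summand. Junk letters have the value 0,
  which marked letters exceed.\<close>

lemma coarse_marked:
  assumes q: "linear_order_on Alph q" and A: "finite A" "A \<subseteq> Alph" "a \<in> A" and eq: "coarse q A z = coarse q A a"
  shows "z = a"
proof (rule ccontr)
  assume "z \<noteq> a"
  have q': "trans q" "antisym q" "total_on Alph q" "refl_on Alph q" "q \<subseteq> Alph \<times> Alph"
    using q by (auto simp: order_on_defs)
  have aa: "(a, a) \<in> q" using q'(4) A by (auto simp: refl_on_def)
  consider "z \<notin> Alph" | "(z, a) \<in> q" | "(a, z) \<in> q"
    using q'(3) A \<open>z \<noteq> a\<close> unfolding total_on_def by blast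
  then show False
  proof cases
    case 1
    then have "{b \<in> A. (b, z) \<in> q} = {}" "{b \<in> A. (b, z) \<in> q \<and> b \<noteq> z} = {}" using q'(5) by auto
    then have "coarse q A z = 0" unfolding coarse_def by (simp only: card.empty add_0)
    moreover have "card {b \<in> A. (b, a) \<in> q} > 0" using A aa by (subst card_gt_0_iff) auto
    ultimately show False using eq unfolding coarse_def by simp
  next
    case 2
    have "card {b \<in> A. (b, z) \<in> q} < card {b \<in> A. (b, a) \<in> q}"
    proof (rule psubset_card_mono)
      have "{b \<in> A. (b, z) \<in> q} \<subseteq> {b \<in> A. (b, a) \<in> q}" using 2 q'(1) by (auto dest: transD)
      moreover have "(a, z) \<notin> q" using 2 q'(2) \<open>z \<noteq> a\<close> by (auto dest: antisymD)
      ultimately show "{b \<in> A. (b, z) \<in> q} \<subset> {b \<in> A. (b, a) \<in> q}" using A aa by blast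
    qed (use A in auto)
    moreover have "card {b \<in> A. (b, z) \<in> q \<and> b \<noteq> z} \<le> card {b \<in> A. (b, a) \<in> q \<and> b \<noteq> a}"
      using 2 A q'(1,2) by (intro card_mono) (auto dest: transD antisymD)
    ultimately show False using eq unfolding coarse_def by simp
  next
    case 3
    have "card {b \<in> A. (b, a) \<in> q \<and> b \<noteq> a} < card {b \<in> A. (b, z) \<in> q \<and> b \<noteq> z}"
    proof (rule psubset_card_mono)
      have "{b \<in> A. (b, a) \<in> q \<and> b \<noteq> a} \<subseteq> {b \<in> A. (b, z) \<in> q \<and> b \<noteq> z}"
        using 3 q'(1,2) by (auto dest: transD antisymD)
      then show "{b \<in> A. (b, a) \<in> q \<and> b \<noteq> a} \<subset> {b \<in> A. (b, z) \<in> q \<and> b \<noteq> z}" using A 3 \<open>z \<noteq> a\<close> by blast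
    qed (use A in auto)
    moreover have "card {b \<in> A. (b, a) \<in> q} \<le> card {b \<in> A. (b, z) \<in> q}"
      using 3 A q'(1) by (intro card_mono) (auto dest: transD)
    ultimately show False using eq unfolding coarse_def by simp
  qed
qed

text \<open>The condition is symmetric in the two directions, so it passes to the converse order,
  which is used for columns.\<close>

definition monotone_on_G :: "letter rel \<Rightarrow> bool" where
  "monotone_on_G q \<longleftrightarrow> (\<forall>r\<in>{0..1}. \<forall>s\<in>{0..1}. (G r, G s) \<in> q \<longleftrightarrow> r \<le> s) \<or>
      (\<forall>r\<in>{0..1}. \<forall>s\<in>{0..1}. (G r, G s) \<in> q \<longleftrightarrow> s \<le> r)"

text \<open>The trace of the set on \<open>G\<close> is an interval, hence Borel: whichever
  direction \<open>q\<close> has on \<open>G\<close>, a point between two members lies above one of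
  them.\<close>

lemma upset_letter_sets:
  assumes q: "linear_order_on Alph q" and G: "monotone_on_G q"
  shows "{z. (a, z) \<in> q} \<in> letter_sets"
proof -
  have q': "trans q" "q \<subseteq> Alph \<times> Alph" using q by (auto simp: order_on_defs)
  have 01: "r \<in> {0..1}" if "(a, G r) \<in> q" for r
    using that q'(2) by (auto simp: Alph_def G_set_def Le_set_def Lo_set_def)
  have "(a, G s) \<in> q" if "(a, G r) \<in> q" "(a, G t) \<in> q" "r \<le> s" "s \<le> t" for r s t
  proof -
    have rst: "r \<in> {0..1}" "s \<in> {0..1}" "t \<in> {0..1}" using that 01[of r] 01[of t] by auto
    from G have "(G r, G s) \<in> q \<or> (G t, G s) \<in> q"
      unfolding monotone_on_G_def using rst that(3,4) by blast
    then show ?thesis using q'(1) that by (meson transD)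
  qed
  then have "is_interval {r. (a, G r) \<in> q}" unfolding is_interval_1 by blast
  then show ?thesis by (simp add: letter_sets_def real_interval_borel_measurable)
qed

lemma coarse_measurable:
  assumes q: "linear_order_on Alph q" and G: "monotone_on_G q" and A: "finite A"
  shows "coarse q A \<in> measurable (mu1 \<alpha> \<beta> \<gamma>) (count_space UNIV)"
proof -
  let ?M = "mu1 \<alpha> \<beta> \<gamma>"
  have up: "{z. (a, z) \<in> q} \<in> sets ?M" for a using upset_letter_sets[OF q G] by simp
  moreover have "{z. (a, z) \<in> q \<and> a \<noteq> z} = {z. (a, z) \<in> q} - {a}" for a by auto
  ultimately have up': "{z. (a, z) \<in> q \<and> a \<noteq> z} \<in> sets ?M" for a
    using singleton_letter_sets[of a] by (metis sets.Diff sets_mu1)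
  have "real (coarse q A z) = (\<Sum>a\<in>A. indicator {z. (a, z) \<in> q} z + indicator {z. (a, z) \<in> q \<and> a \<noteq> z} z)" for z
    using A by (simp add: coarse_def sum.distrib indicator_def sum.If_cases Int_def if_distrib)
  moreover have "(\<lambda>z. \<Sum>a\<in>A. indicator {z. (a, z) \<in> q} z + indicator {z. (a, z) \<in> q \<and> a \<noteq> z} z :: real) \<in> borel_measurable ?M"
    using up up' by (intro borel_measurable_sum borel_measurable_add borel_measurable_indicator)
  ultimately have rm: "(\<lambda>z. real (coarse q A z)) \<in> borel_measurable ?M" by simp
  show ?thesis unfolding measurable_count_space_eq2_countable
  proof (intro conjI ballI)
    fix x
    have "(\<lambda>z. real (coarse q A z)) -` {real x} \<inter> space ?M \<in> sets ?M"
      using rm by (rule measurable_sets) auto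
    then show "coarse q A -` {x} \<inter> space ?M \<in> sets ?M" by (simp add: vimage_def)
  qed auto
qed

text \<open>Two reals of the same fibre cannot be separated by a grid point \<open>i / N\<close>, whether \<open>q\<close>
  agrees with the order of the reals or reverses it.\<close>

lemma coarse_cell:
  assumes q: "linear_order_on Alph q" and G: "monotone_on_G q" and A: "finite A" "A \<subseteq> Alph"
    and N: "0 < N" "(\<lambda>i. G (real i / real N)) ` {..N} \<subseteq> A"
    and x: "x \<notin> coarse q A ` A"
  shows "emeasure lborel ({0..1} \<inter> {r. coarse q A (G r) = x}) \<le> ennreal (1 / real N)"
proof (cases "{0..1} \<inter> {r. coarse q A (G r) = x} = {}")
  case False
  let ?R = "{0..1} \<inter> {r. coarse q A (G r) = x}"
  have le: "\<lfloor>s * real N\<rfloor> \<le> \<lfloor>r * real N\<rfloor>" if rs: "r \<in> ?R" "s \<in> ?R" for r s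
  proof (rule ccontr)
    assume "\<not> ?thesis"
    then have lt: "\<lfloor>r * real N\<rfloor> < \<lfloor>s * real N\<rfloor>" by simp
    \<comment> \<open>The grid point \<open>i / N\<close> separates \<open>r\<close> from
      \<open>s\<close>. By monotonicity \<open>coarse\<close> takes the value \<open>x\<close> there
      too, although \<open>x\<close> is not attained on marked letters.\<close>
    define i where "i = nat \<lfloor>s * real N\<rfloor>"
    have i: "int i = \<lfloor>s * real N\<rfloor>" using rs by (simp add: i_def)
    have "real i \<le> s * real N" using i by linarith
    moreover have "s * real N \<le> real N" using rs by (simp add: mult_left_le_one_le)
    ultimately have iN: "i \<le> N" by simp
    have "r * real N < real i" using lt i by linarith
    then have mid: "r \<le> real i / real N" "real i / real N \<le> s" "real i / real N \<in> {0..1}"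
      using \<open>real i \<le> s * real N\<close> N(1) iN by (simp_all add: field_simps)
    let ?g = "G (real i / real N)"
    have "(G r, ?g) \<in> q \<and> (?g, G s) \<in> q \<or> (G s, ?g) \<in> q \<and> (?g, G r) \<in> q"
      using G mid rs unfolding monotone_on_G_def by auto
    then have "coarse q A ?g = x"
      using coarse_mono[OF q A(1), of "G r" ?g] coarse_mono[OF q A(1), of ?g "G s"]
        coarse_mono[OF q A(1), of "G s" ?g] coarse_mono[OF q A(1), of ?g "G r"] rs by auto
    moreover have "?g \<in> A" using N(2) iN by auto
    ultimately show False using x by blast
  qed
  obtain r where r: "r \<in> ?R" using False by blast
  define j where "j = \<lfloor>r * real N\<rfloor>"
  have "?R \<subseteq> {real_of_int j / real N .. (real_of_int j + 1) / real N}"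
  proof
    fix s assume "s \<in> ?R"
    then have "\<lfloor>s * real N\<rfloor> = j" using le[OF r, of s] le[of s r] r unfolding j_def by force
    then show "s \<in> {real_of_int j / real N .. (real_of_int j + 1) / real N}"
      using N(1) floor_correct[of "s * real N"] by (simp add: field_simps)
  qed
  then have "emeasure lborel ?R \<le> emeasure lborel {real_of_int j / real N .. (real_of_int j + 1) / real N}"
    by (intro emeasure_mono) auto
  also have "\<dots> = ennreal (1 / real N)" using N(1) by (simp add: divide_simps)
  finally show ?thesis .
qed simp

lemma suminf_tail_le:
  fixes a :: "nat \<Rightarrow> real"
  assumes "summable a" "\<And>i. 0 \<le> a i" "\<And>i. i < n \<Longrightarrow> h i \<notin> S"
  shows "(\<Sum>i. ennreal (a i) * indicator S (h i)) \<le> ennreal (\<Sum>i. a (i + n))"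
proof -
  have "(\<Sum>i. ennreal (a i) * indicator S (h i)) =
      (\<Sum>i. ennreal (a (i + n)) * indicator S (h (i + n))) + (\<Sum>i<n. ennreal (a i) * indicator S (h i))"
    by (rule suminf_offset) simp
  also have "(\<Sum>i<n. ennreal (a i) * indicator S (h i)) = 0"
    using assms(3) by (intro sum.neutral) auto
  also have "(\<Sum>i. ennreal (a (i + n)) * indicator S (h (i + n))) \<le> (\<Sum>i. ennreal (a (i + n)))"
    by (intro suminf_le) (auto simp: indicator_def)
  also have "\<dots> = ennreal (\<Sum>i. a (i + n))"
    using assms(1,2) by (intro suminf_ennreal2) (auto simp: summable_iff_shift)
  finally show ?thesis by simp
qed

text \<open>The marked letters are the first \<open>n\<close> of both discrete kinds and the grid
  points \<open>i / N\<close> of \<open>G\<close>. An unmarked fibre receives at most \<epsilon>/4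
  from each of the two discrete tails and at most \<gamma>/N from \<open>G\<close>; the fibre of a
  grid point is a null singleton.\<close>

lemma coarse_exists:
  assumes t: "thoma_params \<alpha> \<beta> \<gamma>" and q: "linear_order_on Alph q" and G: "monotone_on_G q" and "0 < \<epsilon>"
  obtains n m and c :: "letter \<Rightarrow> nat"
  where "k \<le> n" "c \<in> measurable (mu1 \<alpha> \<beta> \<gamma>) (count_space UNIV)" "\<And>z. c z < m"
    "\<And>z z'. (z, z') \<in> q \<Longrightarrow> c z \<le> c z'"
    "\<And>i z. i \<in> {1..n} \<Longrightarrow> c z = c (X i) \<longleftrightarrow> z = X i" "\<And>i z. i \<in> {1..n} \<Longrightarrow> c z = c (Y i) \<longleftrightarrow> z = Y i"
    "\<And>x. x \<notin> c ` X ` {1..n} \<Longrightarrow> x \<notin> c ` Y ` {1..n} \<Longrightarrow> measure (mu1 \<alpha> \<beta> \<gamma>) {z. c z = x} \<le> \<epsilon>"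
proof -
  interpret prob_space "mu1 \<alpha> \<beta> \<gamma>" by (rule prob_space_mu1[OF t])
  note s = thoma_summable[OF t] and nn = thoma_nonneg[OF t]
  have e4: "0 < \<epsilon> / 4" using \<open>0 < \<epsilon>\<close> by simp
  obtain n1 where n1: "\<And>n. n \<ge> n1 \<Longrightarrow> norm (\<Sum>i. \<alpha> (Suc (i + n))) < \<epsilon> / 4"
    using suminf_exist_split[OF e4 s(1)] by auto
  obtain n2 where n2: "\<And>n. n \<ge> n2 \<Longrightarrow> norm (\<Sum>i. \<beta> (Suc (i + n))) < \<epsilon> / 4"
    using suminf_exist_split[OF e4 s(2)] by auto
  define n where "n = max k (max n1 n2)"
  have n: "k \<le> n" "(\<Sum>i. \<alpha> (Suc (i + n))) \<le> \<epsilon> / 4" "(\<Sum>i. \<beta> (Suc (i + n))) \<le> \<epsilon> / 4"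
    using n1[of n] n2[of n] unfolding n_def real_norm_def by linarith+
  obtain N :: nat where N: "0 < N" "\<gamma> / real N \<le> \<epsilon> / 2"
  proof -
    obtain N :: nat where N: "real N > 2 * \<gamma> / \<epsilon>" using reals_Archimedean2 by blast
    then have "0 < N" using nn(5)[of 1] \<open>0 < \<epsilon>\<close> by (metis divide_nonneg_pos le_less_trans mult_nonneg_nonneg of_nat_0_less_iff order.refl zero_le_numeral)
    then show ?thesis using N \<open>0 < \<epsilon>\<close> by (intro that[of N]) (auto simp: field_simps)
  qed
  define A where "A = X ` {1..n} \<union> Y ` {1..n} \<union> (\<lambda>i. G (real i / real N)) ` {..N}"
  have A: "finite A" "A \<subseteq> Alph"
    using N by (auto simp: A_def Alph_def Le_set_def Lo_set_def G_set_def)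
  let ?c = "coarse q A"
  have cm: "?c \<in> measurable (mu1 \<alpha> \<beta> \<gamma>) (count_space UNIV)" by (rule coarse_measurable[OF q G A(1)])
  have fib: "{z. ?c z = x} \<in> letter_sets" for x
    using measurable_sets[OF cm, of "{x}"] by (simp add: vimage_def)
  have small: "measure (mu1 \<alpha> \<beta> \<gamma>) {z. ?c z = x} \<le> \<epsilon>" if x: "x \<notin> ?c ` X ` {1..n}" "x \<notin> ?c ` Y ` {1..n}" for x
  proof (cases "x \<in> ?c ` A")
    case True
    then obtain i where i: "x = ?c (G (real i / real N))" "i \<le> N" using x by (auto simp: A_def)
    then have "{z. ?c z = x} = {G (real i / real N)}"
      using coarse_marked[OF q A, of "G (real i / real N)"] by (auto simp: A_def)
    then show ?thesis using measure_mu1_singleton(3)[OF t] \<open>0 < \<epsilon>\<close> by simp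
  next
    case False
    let ?S = "{z. ?c z = x}"
    have "emeasure (mu1 \<alpha> \<beta> \<gamma>) ?S \<le> ennreal (\<epsilon> / 4) + ennreal (\<epsilon> / 4) + ennreal \<gamma> * ennreal (1 / real N)"
      unfolding emeasure_mu1[OF fib]
    proof (intro add_mono mult_left_mono)
      show "(\<Sum>i. ennreal (\<alpha> (Suc i)) * indicator ?S (X (Suc i))) \<le> ennreal (\<epsilon> / 4)"
        using suminf_tail_le[OF s(1) _, of n "\<lambda>i. X (Suc i)" ?S] nn x n(2) by (force intro: order_trans ennreal_leI)
      show "(\<Sum>i. ennreal (\<beta> (Suc i)) * indicator ?S (Y (Suc i))) \<le> ennreal (\<epsilon> / 4)"
        using suminf_tail_le[OF s(2) _, of n "\<lambda>i. Y (Suc i)" ?S] nn x n(3) by (force intro: order_trans ennreal_leI)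
      show "emeasure lborel ({0..1} \<inter> {r. G r \<in> ?S}) \<le> ennreal (1 / real N)"
        using coarse_cell[OF q G A N(1) _ False] by (simp add: A_def)
    qed simp
    also have "\<dots> = ennreal (\<epsilon> / 4 + \<epsilon> / 4 + \<gamma> * (1 / real N))"
    proof -
      have "ennreal \<gamma> * ennreal (1 / real N) = ennreal (\<gamma> * (1 / real N))"
        using nn(5)[of 1] by (intro ennreal_mult[symmetric]) auto
      then show ?thesis using \<open>0 < \<epsilon>\<close> nn(5)[of 1] by (simp flip: ennreal_plus)
    qed
    also have "\<dots> \<le> ennreal \<epsilon>"
    proof (rule ennreal_leI)
      show "\<epsilon> / 4 + \<epsilon> / 4 + \<gamma> * (1 / real N) \<le> \<epsilon>"
        using N(2) unfolding times_divide_eq_right mult_1_right by linarith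
    qed
    finally show ?thesis using \<open>0 < \<epsilon>\<close> by (simp add: emeasure_eq_measure)
  qed
  have marked: "?c z = ?c (X i) \<longleftrightarrow> z = X i" "?c z = ?c (Y i) \<longleftrightarrow> z = Y i" if "i \<in> {1..n}" for i z
    using coarse_marked[OF q A] that by (auto simp: A_def)
  show ?thesis
    by (rule that[OF n(1) cm coarse_less[OF A(1)] coarse_mono[OF q A(1)] marked small])
qed

section \<open>Rows and columns of the RSK shape\<close>

text \<open>The common part of \<open>H\<close> and \<open>D\<close> cancels. Each piece of
  \<open>H - D\<close> outside \<open>E\<close> has weight at most \<open>b\<close>, each piece of
  \<open>D - H\<close> has at least \<open>\<delta> + b\<close>, and there are at least as many of
  the latter. Since \<open>D - H\<close> is nonempty, a surplus of \<delta> remains.\<close>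

lemma (in prob_space) gap_of_weights:
  fixes c :: "'a \<Rightarrow> nat"
  assumes c: "c \<in> measurable M (count_space UNIV)"
    and D: "finite D" "D \<inter> E = {}" and H: "finite H" "card H \<le> card D" "\<not> D \<subseteq> H"
    and w: "\<And>x. x \<in> D \<Longrightarrow> \<delta> + b \<le> prob {z \<in> space M. c z = x}"
      "\<And>x. x \<notin> D \<Longrightarrow> x \<notin> E \<Longrightarrow> prob {z \<in> space M. c z = x} \<le> b"
    and "0 \<le> b" "0 \<le> \<delta>"
  shows "prob {z \<in> space M. c z \<in> H - E} \<le> prob {z \<in> space M. c z \<in> D} - \<delta>"
proof -
  let ?v = "\<lambda>x. prob {z \<in> space M. c z = x}"
  have sum_v: "prob {z \<in> space M. c z \<in> S} = sum ?v S" if "finite S" for S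
  proof -
    have "{z \<in> space M. c z \<in> S} = (\<Union>x\<in>S. {z \<in> space M. c z = x})" by auto
    moreover have "prob (\<Union>x\<in>S. {z \<in> space M. c z = x}) = sum ?v S"
    proof (rule finite_measure_finite_Union[OF that])
      show "(\<lambda>x. {z \<in> space M. c z = x}) ` S \<subseteq> events" using c by auto
    qed (auto simp: disjoint_family_on_def)
    ultimately show ?thesis by simp
  qed
  have "card (D - H) \<noteq> 0" using H(3) D(1) by auto
  then have one: "1 \<le> card (D - H)" by linarith
  have "card D = card (D \<inter> H) + card (D - H)" "card H = card (H \<inter> D) + card (H - D)"
    using D(1) H(1) card_Int_Diff by blast+
  then have cards: "card (H - D) \<le> card (D - H)" using H(2) by (simp add: Int_commute)
  have "sum ?v (H - E) \<le> sum ?v ((H \<inter> D) \<union> (H - D - E))"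
    using H(1) by (intro sum_mono2) auto
  also have "\<dots> = sum ?v (H \<inter> D) + sum ?v (H - D - E)"
    using H(1) by (intro sum.union_disjoint) auto
  also have "sum ?v (H - D - E) \<le> real (card (H - D - E)) * b"
    using w(2) by (intro sum_bounded_above) auto
  also have "\<dots> \<le> real (card (D - H)) * b"
    using cards card_mono[of "H - D" "H - D - E"] H(1) \<open>0 \<le> b\<close> by (intro mult_right_mono) auto
  also have "real (card (D - H)) * b \<le> sum ?v (D - H) - \<delta>"
  proof -
    have "real (card (D - H)) * (\<delta> + b) \<le> sum ?v (D - H)"
      using w(1) by (intro sum_bounded_below) auto
    moreover have "1 * \<delta> \<le> real (card (D - H)) * \<delta>"
      using one \<open>0 \<le> \<delta>\<close> by (intro mult_right_mono) auto
    ultimately show ?thesis by (simp add: distrib_left)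
  qed
  also have "sum ?v (H \<inter> D) + (sum ?v (D - H) - \<delta>) = sum ?v D - \<delta>"
    using sum.Int_Diff[OF D(1), of ?v H] by (simp add: Int_commute)
  finally show ?thesis using sum_v[of "H - E"] sum_v[of D] H(1) D(1) by simp
qed

text \<open>Rows and columns are treated together: a chain may repeat the letters of
  \<open>P\<close> but not those of \<open>Q\<close>. The letters of \<open>Q\<close> may be heavier
  than \<open>a k\<close>, so the first \<open>n\<close> of them form the set \<open>E\<close>,
  where the bound on repetitions replaces the bound on weights.\<close>

lemma chains_bound:
  assumes t: "thoma_params \<alpha> \<beta> \<gamma>" and q: "linear_order_on Alph q" "monotone_on_G q"
    and PQ: "P = X \<and> Q = Y \<and> a = \<alpha> \<or> P = Y \<and> Q = X \<and> a = \<beta>"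
    and k: "1 \<le> k" "a (Suc k) < a k"
  shows "\<exists>C\<ge>0. \<forall>n. \<exists>g. chains_bounded (mu1 \<alpha> \<beta> \<gamma>)
     (\<lambda>x y. (x, y) \<in> q \<and> (x = y \<longrightarrow> x \<notin> range Q)) (P ` {1..k}) k C n g"
proof -
  interpret prob_space "mu1 \<alpha> \<beta> \<gamma>" by (rule prob_space_mu1[OF t])
  let ?M = "mu1 \<alpha> \<beta> \<gamma>"
  have mP: "measure ?M {P i} = a i" if "1 \<le> i" for i
    using PQ measure_mu1_singleton[OF t] that by auto
  have anti: "a j \<le> a i" if "1 \<le> i" "i \<le> j" for i j
    using PQ thoma_antimono[OF t that] by auto
  have a0: "0 \<le> a i" if "1 \<le> i" for i using PQ thoma_nonneg[OF t that] by auto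
  have inj: "P i = P j \<longleftrightarrow> i = j" "P i \<noteq> Q j" for i j using PQ by auto
  define \<epsilon> where "\<epsilon> = a k / 2"
  have "0 < \<epsilon>" using k a0[of "Suc k"] by (simp add: \<epsilon>_def)
  then obtain n m and c :: "letter \<Rightarrow> nat" where n: "k \<le> n"
    and c: "c \<in> measurable ?M (count_space UNIV)" "\<And>z. c z < m"
    and mono: "\<And>z z'. (z, z') \<in> q \<Longrightarrow> c z \<le> c z'"
    and marked: "\<And>i z. i \<in> {1..n} \<Longrightarrow> c z = c (X i) \<longleftrightarrow> z = X i" "\<And>i z. i \<in> {1..n} \<Longrightarrow> c z = c (Y i) \<longleftrightarrow> z = Y i"
    and small: "\<And>x. x \<notin> c ` X ` {1..n} \<Longrightarrow> x \<notin> c ` Y ` {1..n} \<Longrightarrow> measure ?M {z. c z = x} \<le> \<epsilon>"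
    using coarse_exists[OF t q] by metis
  have mkP: "c z = c (P i) \<longleftrightarrow> z = P i" and mkQ: "c z = c (Q i) \<longleftrightarrow> z = Q i" if "i \<in> {1..n}" for z i
    using marked[OF that] PQ by auto
  define D where "D = c ` P ` {1..k}"
  define E where "E = c ` Q ` {1..n}"
  \<comment> \<open>With half of the gap, \<open>a k - \<delta>\<close> is the midpoint between
    \<open>a (Suc k)\<close> and \<open>a k\<close>. It bounds the weights of the later letters of
    \<open>P\<close>, and also \<epsilon>, because \<open>a (Suc k)\<close> is nonnegative.\<close>
  define \<delta> where "\<delta> = (a k - a (Suc k)) / 2"
  have \<delta>: "0 < \<delta>" "\<delta> \<le> 1"
  proof -
    show "0 < \<delta>" using k by (simp add: \<delta>_def)
    have "a k \<le> 1" using mP[of k] k prob_le_1[of "{P k}"] by simp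
    then show "\<delta> \<le> 1" using a0[of "Suc k"] by (simp add: \<delta>_def)
  qed
  have cardD: "card D = k"
  proof -
    have "inj_on (c \<circ> P) {1..k}"
      using mkP n inj by (intro inj_onI) auto
    then show ?thesis unfolding D_def image_comp using card_image[of "c \<circ> P" "{1..k}"] by simp
  qed
  have DE: "D \<inter> E = {}" using mkQ inj n by (auto simp: D_def E_def)
  have b: "0 \<le> a k - \<delta>" "a (Suc k) \<le> a k - \<delta>" "\<epsilon> \<le> a k - \<delta>"
    using k a0[of "Suc k"] by (auto simp: \<delta>_def \<epsilon>_def field_simps)
  have fP: "{z. c z = c (P i)} = {P i}" if "i \<in> {1..n}" for i
    using mkP[OF that] by auto
  have gap: "prob {z \<in> space ?M. c z \<in> H - E} \<le> prob {z \<in> space ?M. c z \<in> D} - \<delta>"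
    if H: "finite H" "card H \<le> k" "\<not> D \<subseteq> H" for H
  proof (rule gap_of_weights[where b = "a k - \<delta>"])
    show "\<delta> + (a k - \<delta>) \<le> prob {z \<in> space ?M. c z = x}" if "x \<in> D" for x
    proof -
      from \<open>x \<in> D\<close> obtain i where i: "i \<in> {1..k}" "x = c (P i)" unfolding D_def by blast
      then show ?thesis using fP[of i] mP[of i] n anti[of i k] by simp
    qed
    show "prob {z \<in> space ?M. c z = x} \<le> a k - \<delta>" if "x \<notin> D" "x \<notin> E" for x
    proof (cases "x \<in> c ` P ` {1..n}")
      case True
      then obtain i where i: "i \<in> {1..n}" "x = c (P i)" by auto
      then have "Suc k \<le> i" using that(1) by (force simp: D_def)
      then have "a i \<le> a (Suc k)" by (intro anti) auto
      then show ?thesis using i fP[of i] mP[of i] b(2) by simp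
    next
      case False
      then have "measure ?M {z. c z = x} \<le> \<epsilon>"
        using that(2) PQ unfolding E_def by (intro small) auto
      then show ?thesis using b(3) by simp
    qed
  qed (use c DE H cardD b \<delta> in \<open>auto simp: D_def\<close>)
  have setD: "{z. c z \<in> D} = P ` {1..k}"
    using mkP n unfolding D_def by (auto simp: image_iff)
  have finE: "finite E" by (simp add: E_def)
  have trans: "c z \<le> c z' \<and> (c z = c z' \<longrightarrow> c z \<notin> E)"
    if "(z, z') \<in> q \<and> (z = z' \<longrightarrow> z \<notin> range Q)" for z z'
  proof (intro conjI impI)
    show "c z \<le> c z'" using that mono by blast
    assume eq: "c z = c z'"
    show "c z \<notin> E"
    proof
      assume "c z \<in> E"
      then obtain i where i: "i \<in> {1..n}" "c z = c (Q i)" by (auto simp: E_def)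
      then have "z = Q i" "z' = Q i" using mkQ[OF i(1)] eq by auto
      then show False using that by simp
    qed
  qed
  have "\<exists>C\<ge>0. \<forall>n. \<exists>g. chains_bounded ?M (\<lambda>x y. c x \<le> c y \<and> (c x = c y \<longrightarrow> c x \<notin> E)) (P ` {1..k}) k C n g"
    using chains_excess_expectation[OF c \<delta> cardD DE finE gap] unfolding setD .
  then obtain C where C: "0 \<le> C"
    "\<And>n. \<exists>g. chains_bounded ?M (\<lambda>x y. c x \<le> c y \<and> (c x = c y \<longrightarrow> c x \<notin> E)) (P ` {1..k}) k C n g"
    by blast
  show ?thesis
  proof (intro exI[of _ C] conjI allI C(1))
    fix n
    obtain g where "chains_bounded ?M (\<lambda>x y. c x \<le> c y \<and> (c x = c y \<longrightarrow> c x \<notin> E)) (P ` {1..k}) k C n g"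
      using C(2) by blast
    from chains_bounded_mono[OF this, of "\<lambda>x y. (x, y) \<in> q \<and> (x = y \<longrightarrow> x \<notin> range Q)"] trans
    show "\<exists>g. chains_bounded ?M (\<lambda>x y. (x, y) \<in> q \<and> (x = y \<longrightarrow> x \<notin> range Q)) (P ` {1..k}) k C n g"
      by blast
  qed
qed

lemma sorted_wrt_filter_upt:
  "sorted_wrt R (filter Q [0..<n]) \<longleftrightarrow> (\<forall>a b. a < b \<longrightarrow> b < n \<longrightarrow> Q a \<longrightarrow> Q b \<longrightarrow> R a b)"
proof (induction n)
  case (Suc n)
  then show ?case by (auto simp: sorted_wrt_append less_Suc_eq)
qed simp

lemma chain_sizes_upt:
  "chain_sizes R k [0..<n] = {card {t. t < n \<and> f t < k} | f :: nat \<Rightarrow> nat.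
     \<forall>a b. a < b \<longrightarrow> b < n \<longrightarrow> f a = f b \<longrightarrow> f a < k \<longrightarrow> R a b}"
proof -
  have "length (filter Q [0..<n]) = card {t. t < n \<and> Q t}" for Q
    by (simp add: length_filter_conv_card cong: conj_cong)
  moreover have "(\<forall>c<k. sorted_wrt R (filter (\<lambda>x. f x = c) [0..<n])) \<longleftrightarrow>
      (\<forall>a b. a < b \<longrightarrow> b < n \<longrightarrow> f a = f b \<longrightarrow> f a < k \<longrightarrow> R a b)" for f :: "nat \<Rightarrow> nat"
    unfolding sorted_wrt_filter_upt by auto
  ultimately show ?thesis unfolding chain_sizes_def by simp
qed

lemma count_letter_card: "count_letter a n w = card {t. t < n \<and> w t = a}"
  unfolding count_letter_def word_def by (simp add: length_filter_conv_card cong: conj_cong)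

lemma sum_count_letter:
  fixes P :: "nat \<Rightarrow> letter"
  assumes "inj P"
  shows "(\<Sum>i=1..k. count_letter (P i) n w) = card {t. t < n \<and> w t \<in> P ` {1..k}}"
proof -
  have "{t. t < n \<and> w t \<in> P ` {1..k}} = (\<Union>i\<in>{1..k}. {t. t < n \<and> w t = P i})" by auto
  moreover have "card (\<Union>i\<in>{1..k}. {t. t < n \<and> w t = P i}) = (\<Sum>i=1..k. card {t. t < n \<and> w t = P i})"
    using assms by (intro card_UN_disjoint) (auto dest: injD)
  ultimately show ?thesis by (simp add: count_letter_card)
qed

lemma letters_chain_sizes:
  fixes P :: "nat \<Rightarrow> letter"
  assumes "inj P" and R: "\<And>s t i. s < t \<Longrightarrow> w s = P i \<Longrightarrow> w t = P i \<Longrightarrow> 1 \<le> i \<Longrightarrow> R s t"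
  shows "(\<Sum>i=1..k. count_letter (P i) n w) \<in> chain_sizes R k [0..<n]"
proof -
  \<comment> \<open>Letters are numbered from 1 and chains from 0, hence the shift; the colour
    \<open>k\<close> means uncovered.\<close>
  define f where "f t = (if w t \<in> P ` {1..k} then inv P (w t) - 1 else k)" for t
  have f: "f t < k \<longleftrightarrow> w t \<in> P ` {1..k}" for t using assms(1) by (auto simp: f_def)
  have "R s t" if "s < t" "f s = f t" "f s < k" for s t
  proof -
    have "w s \<in> P ` {1..k}" "w t \<in> P ` {1..k}" using that unfolding f[symmetric] by simp_all
    then obtain i j where ij: "i \<in> {1..k}" "j \<in> {1..k}" "w s = P i" "w t = P j" by blast
    then have "i - 1 = j - 1" using that(2) assms(1) by (simp add: f_def)
    then have "i = j" using ij by auto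
    then show ?thesis using R[of s t i] that ij by auto
  qed
  moreover have "(\<Sum>i=1..k. count_letter (P i) n w) = card {t. t < n \<and> f t < k}"
    unfolding f by (rule sum_count_letter[OF assms(1)])
  ultimately show ?thesis unfolding chain_sizes_upt by blast
qed

lemma AE_word_Alph:
  assumes "thoma_params \<alpha> \<beta> \<gamma>"
  shows "AE w in mun \<alpha> \<beta> \<gamma> n. \<forall>t<n. w t \<in> Alph"
proof -
  have "AE w in mun \<alpha> \<beta> \<gamma> n. \<forall>t\<in>{..<n}. w t \<in> Alph"
    unfolding mun_def
    by (intro AE_finite_allI AE_PiM_component prob_space_mu1[OF assms] AE_Alph) auto
  then show ?thesis unfolding Ball_def lessThan_iff .
qed

text \<open>The value \<open>X 1\<close> beyond the word only serves to make \<open>prec\<close> total on all positions.\<close>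

definition alph_word :: "nat \<Rightarrow> (nat \<Rightarrow> letter) \<Rightarrow> nat \<Rightarrow> letter" where
  "alph_word n w t = (if t < n then w t else X 1)"

lemma alph_word:
  assumes "\<forall>t<n. w t \<in> Alph"
  shows "alph_word n w t \<in> Alph" "word n (alph_word n w) = word n w"
    "count_letter a n (alph_word n w) = count_letter a n w"
proof -
  show "alph_word n w t \<in> Alph" using assms by (auto simp: alph_word_def Alph_def Le_set_def)
  show word: "word n (alph_word n w) = word n w" by (simp add: word_def alph_word_def)
  show "count_letter a n (alph_word n w) = count_letter a n w" unfolding count_letter_def word ..
qed

text \<open>The lower bound 0 is kept beside the majorant because single terms are recovered as
  differences of consecutive partial sums.\<close>

definition mean_bounded :: "'a measure \<Rightarrow> real \<Rightarrow> ('a \<Rightarrow> int) \<Rightarrow> bool" where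
  "mean_bounded M C S \<longleftrightarrow> (\<exists>g\<in>borel_measurable M. (\<forall>w. 0 \<le> (g w :: real)) \<and>
     (\<integral>\<^sup>+ w. ennreal (g w) \<partial>M) \<le> ennreal C \<and> (AE w in M. 0 \<le> S w \<and> real_of_int (S w) \<le> g w))"

text \<open>The lower bound holds because the occurrences of the first \<open>k\<close> letters
  \<open>X i\<close> are admissible chains in Greene's theorem. For the upper bound, the extremal
  chains are increasing for \<open>prec\<close>, so they are monotone for \<open>p\<close> and
  repeat a letter only if it belongs to \<open>Le_set\<close>; in particular they never repeat a
  letter \<open>Y j\<close>.\<close>

lemma sum_eps_bounds:
  assumes t: "thoma_params \<alpha> \<beta> \<gamma>" and p: "linear_order_on Alph p" "monotone_on_G p"
    and k: "1 \<le> k" "\<alpha> (Suc k) < \<alpha> k"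
  shows "\<exists>C\<ge>0. \<forall>n. mean_bounded (mun \<alpha> \<beta> \<gamma> n) C (\<lambda>w. \<Sum>i=1..k. eps p n i w)"
proof -
  from chains_bound[OF t p, of X Y \<alpha> k] k
  obtain C where C: "0 \<le> C" "\<And>n. \<exists>g. chains_bounded (mu1 \<alpha> \<beta> \<gamma>)
     (\<lambda>x y. (x, y) \<in> p \<and> (x = y \<longrightarrow> x \<notin> range Y)) (X ` {1..k}) k C n g"
    by blast
  show ?thesis
  proof (intro exI[of _ C] conjI allI C(1))
    fix n
    obtain g where g: "chains_bounded (mu1 \<alpha> \<beta> \<gamma>)
     (\<lambda>x y. (x, y) \<in> p \<and> (x = y \<longrightarrow> x \<notin> range Y)) (X ` {1..k}) k C n g"
      using C(2) by blast
    note bd = g[unfolded chains_bounded_def, THEN conjunct2, THEN conjunct2, THEN conjunct2, rule_format]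
    have "0 \<le> (\<Sum>i=1..k. eps p n i w) \<and> real_of_int (\<Sum>i=1..k. eps p n i w) \<le> g w"
      if w: "\<forall>t<n. w t \<in> Alph" for w
    proof -
      let ?w = "alph_word n w"
      note aw = alph_word[OF w]
      note gr = greene_phi[where w = ?w and k = k and n = n, OF p(1) aw(1), unfolded aw(2)]
      have sum: "(\<Sum>i=1..k. eps p n i w) = int (\<Sum>i=1..k. row_len (phi p (word n w)) i) - int (\<Sum>i=1..k. count_letter (X i) n w)"
        by (simp add: eps_def sum_subtractf)
      have "(\<Sum>i=1..k. count_letter (X i) n ?w) \<in> chain_sizes (prec p ?w) k [0..<n]"
        by (rule letters_chain_sizes) (auto simp: inj_def prec_def Le_set_def)
      then have "(\<Sum>i=1..k. count_letter (X i) n w) \<le> (\<Sum>i=1..k. row_len (phi p (word n w)) i)"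
        unfolding aw(3) by (rule gr(2))
      moreover from gr(1) obtain f where f: "(\<Sum>i=1..k. row_len (phi p (word n w)) i) = card {t. t < n \<and> f t < k}"
        "\<And>s t. s < t \<Longrightarrow> t < n \<Longrightarrow> f s = f t \<Longrightarrow> f s < k \<Longrightarrow> prec p ?w s t"
        unfolding chain_sizes_upt by blast
      have "real (card {t. t < n \<and> f t < k}) \<le> real (card {t. t < n \<and> w t \<in> X ` {1..k}}) + g w"
      proof (rule bd)
        fix s t assume st: "s < t" "t < n" "f s = f t" "f s < k"
        have "(z, z) \<in> p" if "z \<in> Alph" for z using p(1) that by (auto simp: order_on_defs refl_on_def)
        then show "(w s, w t) \<in> p \<and> (w s = w t \<longrightarrow> w s \<notin> range Y)"
          using f(2)[OF st] st w by (auto simp: prec_def alph_word_def Le_set_def split: if_splits)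
      qed
      ultimately show ?thesis
        unfolding sum f(1) using sum_count_letter[of X n w k] by (auto simp: inj_def)
    qed
    then have "AE w in mun \<alpha> \<beta> \<gamma> n. 0 \<le> (\<Sum>i=1..k. eps p n i w) \<and> real_of_int (\<Sum>i=1..k. eps p n i w) \<le> g w"
      using AE_word_Alph[OF t, of n] by (auto elim: eventually_mono)
    with g show "mean_bounded (mun \<alpha> \<beta> \<gamma> n) C (\<lambda>w. \<Sum>i=1..k. eps p n i w)"
      unfolding mean_bounded_def chains_bounded_def mun_def by blast
  qed
qed

text \<open>Decreasing chains for \<open>prec\<close> are monotone for the converse of
  \<open>p\<close> and repeat only letters outside \<open>Le_set\<close>, so the kinds
  \<open>X\<close> and \<open>Y\<close> exchange their roles.\<close>

lemma sum_eps'_bounds: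
  assumes t: "thoma_params \<alpha> \<beta> \<gamma>" and p: "linear_order_on Alph p" "monotone_on_G p"
    and k: "1 \<le> k" "\<beta> (Suc k) < \<beta> k"
  shows "\<exists>C\<ge>0. \<forall>n. mean_bounded (mun \<alpha> \<beta> \<gamma> n) C (\<lambda>w. \<Sum>i=1..k. eps' p n i w)"
proof -
  have q: "linear_order_on Alph (p\<inverse>)" "monotone_on_G (p\<inverse>)"
    using p by (auto simp: monotone_on_G_def)
  from chains_bound[OF t q, of Y X \<beta> k] k
  obtain C where C: "0 \<le> C" "\<And>n. \<exists>g. chains_bounded (mu1 \<alpha> \<beta> \<gamma>)
     (\<lambda>x y. (x, y) \<in> p\<inverse> \<and> (x = y \<longrightarrow> x \<notin> range X)) (Y ` {1..k}) k C n g"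
    by blast
  show ?thesis
  proof (intro exI[of _ C] conjI allI C(1))
    fix n
    obtain g where g: "chains_bounded (mu1 \<alpha> \<beta> \<gamma>)
     (\<lambda>x y. (x, y) \<in> p\<inverse> \<and> (x = y \<longrightarrow> x \<notin> range X)) (Y ` {1..k}) k C n g"
      using C(2) by blast
    note bd = g[unfolded chains_bounded_def, THEN conjunct2, THEN conjunct2, THEN conjunct2, rule_format]
    have "0 \<le> (\<Sum>i=1..k. eps' p n i w) \<and> real_of_int (\<Sum>i=1..k. eps' p n i w) \<le> g w"
      if w: "\<forall>t<n. w t \<in> Alph" for w
    proof -
      let ?w = "alph_word n w"
      note aw = alph_word[OF w]
      note gr = greene_phi[where w = ?w and k = k and n = n, OF p(1) aw(1), unfolded aw(2)]
      have sum: "(\<Sum>i=1..k. eps' p n i w) = int (\<Sum>i=1..k. col_len (phi p (word n w)) i) - int (\<Sum>i=1..k. count_letter (Y i) n w)"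
        by (simp add: eps'_def sum_subtractf)
      have "(\<Sum>i=1..k. count_letter (Y i) n ?w) \<in> chain_sizes (prec p ?w)\<inverse>\<inverse> k [0..<n]"
        by (rule letters_chain_sizes) (auto simp: inj_def prec_def Le_set_def)
      then have "(\<Sum>i=1..k. count_letter (Y i) n w) \<le> (\<Sum>i=1..k. col_len (phi p (word n w)) i)"
        unfolding aw(3) by (rule gr(4))
      moreover from gr(3) obtain f where f: "(\<Sum>i=1..k. col_len (phi p (word n w)) i) = card {t. t < n \<and> f t < k}"
        "\<And>s t. s < t \<Longrightarrow> t < n \<Longrightarrow> f s = f t \<Longrightarrow> f s < k \<Longrightarrow> prec p ?w t s"
        unfolding chain_sizes_upt conversep_iff by blast
      have "real (card {t. t < n \<and> f t < k}) \<le> real (card {t. t < n \<and> w t \<in> Y ` {1..k}}) + g w"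
      proof (rule bd)
        fix s t assume st: "s < t" "t < n" "f s = f t" "f s < k"
        have "(z, z) \<in> p" if "z \<in> Alph" for z using p(1) that by (auto simp: order_on_defs refl_on_def)
        moreover have "z \<in> Le_set" if "z \<in> Alph" "z \<in> range X" for z
          using that by (auto simp: Alph_def Lo_set_def G_set_def)
        ultimately show "(w s, w t) \<in> p\<inverse> \<and> (w s = w t \<longrightarrow> w s \<notin> range X)"
          using f(2)[OF st] st w by (auto simp: prec_def alph_word_def split: if_splits)
      qed
      ultimately show ?thesis
        unfolding sum f(1) using sum_count_letter[of Y n w k] by (auto simp: inj_def)
    qed
    then have "AE w in mun \<alpha> \<beta> \<gamma> n. 0 \<le> (\<Sum>i=1..k. eps' p n i w) \<and> real_of_int (\<Sum>i=1..k. eps' p n i w) \<le> g w"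
      using AE_word_Alph[OF t, of n] by (auto elim: eventually_mono)
    with g show "mean_bounded (mun \<alpha> \<beta> \<gamma> n) C (\<lambda>w. \<Sum>i=1..k. eps' p n i w)"
      unfolding mean_bounded_def chains_bounded_def mun_def by blast
  qed
qed

text \<open>Each term is the difference of two consecutive partial sums. Both are nonnegative almost
  everywhere, so its absolute value is at most the sum of their majorants.\<close>

lemma nn_integral_abs_of_partial_sums:
  fixes e :: "nat \<Rightarrow> nat \<Rightarrow> 'a \<Rightarrow> int" and \<mu> :: "nat \<Rightarrow> 'a measure"
  assumes "\<And>k. 1 \<le> k \<Longrightarrow> k \<le> K \<Longrightarrow> \<exists>C\<ge>0. \<forall>n. mean_bounded (\<mu> n) C (\<lambda>w. \<Sum>i=1..k. e n i w)"
  shows "\<exists>C::real. \<forall>n. \<forall>k\<in>{1..K}. (\<integral>\<^sup>+ w. ennreal \<bar>real_of_int (e n k w)\<bar> \<partial>\<mu> n) < ennreal C"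
proof -
  have "\<exists>C\<ge>0. \<forall>n. mean_bounded (\<mu> n) C (\<lambda>w. \<Sum>i=1..k. e n i w)" if "k \<le> K" for k
  proof (cases "k = 0")
    case True
    then show ?thesis
      by (intro exI[of _ 0]) (auto simp: mean_bounded_def intro!: bexI[of _ "\<lambda>_. 0"])
  qed (use assms[of k] that in simp)
  then obtain B where B: "\<And>k. k \<le> K \<Longrightarrow> 0 \<le> B k"
    "\<And>k n. k \<le> K \<Longrightarrow> mean_bounded (\<mu> n) (B k) (\<lambda>w. \<Sum>i=1..k. e n i w)"
    by metis
  \<comment> \<open>One sum dominates each of the two bounds \<open>B k\<close> and
    \<open>B l\<close>, whence the factor 2; the summand 1 makes the inequality strict.\<close>
  define C where "C = 2 * (\<Sum>k\<le>K. B k) + 1"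
  have "(\<integral>\<^sup>+ w. ennreal \<bar>real_of_int (e n k w)\<bar> \<partial>\<mu> n) < ennreal C" if k: "k \<in> {1..K}" for n k
  proof -
    obtain l where l: "k = Suc l" "l \<le> K" "k \<le> K" using k by (cases k) auto
    obtain g where g: "g \<in> borel_measurable (\<mu> n)" "\<And>w. 0 \<le> g w" "(\<integral>\<^sup>+ w. ennreal (g w) \<partial>\<mu> n) \<le> ennreal (B k)"
      "AE w in \<mu> n. 0 \<le> (\<Sum>i=1..k. e n i w) \<and> real_of_int (\<Sum>i=1..k. e n i w) \<le> g w"
      using B(2)[OF l(3), of n] unfolding mean_bounded_def by blast
    obtain h where h: "h \<in> borel_measurable (\<mu> n)" "\<And>w. 0 \<le> h w" "(\<integral>\<^sup>+ w. ennreal (h w) \<partial>\<mu> n) \<le> ennreal (B l)"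
      "AE w in \<mu> n. 0 \<le> (\<Sum>i=1..l. e n i w) \<and> real_of_int (\<Sum>i=1..l. e n i w) \<le> h w"
      using B(2)[OF l(2), of n] unfolding mean_bounded_def by blast
    have "(\<integral>\<^sup>+ w. ennreal \<bar>real_of_int (e n k w)\<bar> \<partial>\<mu> n) \<le> (\<integral>\<^sup>+ w. ennreal (g w) + ennreal (h w) \<partial>\<mu> n)"
    proof (rule nn_integral_mono_AE, use g(4) h(4) in eventually_elim)
      case (elim w)
      have "(\<Sum>i=1..k. e n i w) = (\<Sum>i=1..l. e n i w) + e n k w" by (simp add: l(1))
      then have "real_of_int (e n k w) = real_of_int (\<Sum>i=1..k. e n i w) - real_of_int (\<Sum>i=1..l. e n i w)"
        by (simp only: of_int_add add_diff_cancel_left')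
      moreover have "0 \<le> real_of_int (\<Sum>i=1..k. e n i w)" "0 \<le> real_of_int (\<Sum>i=1..l. e n i w)"
        using elim by (simp_all only: of_int_0_le_iff)
      ultimately have "\<bar>real_of_int (e n k w)\<bar> \<le> g w + h w" using elim by linarith
      then show ?case using g(2) h(2) by (simp flip: ennreal_plus)
    qed
    also have "\<dots> = (\<integral>\<^sup>+ w. ennreal (g w) \<partial>\<mu> n) + (\<integral>\<^sup>+ w. ennreal (h w) \<partial>\<mu> n)"
      using g(1) h(1) by (intro nn_integral_add) auto
    also have "\<dots> \<le> ennreal (B k) + ennreal (B l)" by (intro add_mono g(3) h(3))
    also have "\<dots> = ennreal (B k + B l)" using B(1) l by simp
    also have "\<dots> < ennreal C"
    proof (rule ennreal_lessI)
      have "B k \<le> (\<Sum>k\<le>K. B k)" "B l \<le> (\<Sum>k\<le>K. B k)"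
        using B(1) l by (auto intro!: member_le_sum)
      then show "B k + B l < C" by (simp add: C_def)
      have "0 \<le> (\<Sum>k\<le>K. B k)" using B(1) by (intro sum_nonneg) auto
      then show "0 < C" by (simp add: C_def)
    qed
    finally show ?thesis .
  qed
  then show ?thesis by blast
qed

theorem theorem2:
  fixes \<alpha> \<beta> :: "nat \<Rightarrow> real" and \<gamma> :: real and K L :: nat and p :: "letter rel"
  assumes "thoma_params \<alpha> \<beta> \<gamma>"
    and "strictly_monotone_params \<alpha> \<beta>"
    and "K > 0" and "L > 0"
    and "\<forall>i. 1 \<le> i \<and> i < K \<longrightarrow> \<alpha> i > \<alpha> (Suc i)" and "\<alpha> K > 0"
    and "\<forall>j. 1 \<le> j \<and> j < L \<longrightarrow> \<beta> j > \<beta> (Suc j)" and "\<beta> L > 0"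
    and "admissible p"
  shows "\<exists>C::real. \<forall>n\<ge>1.
           (\<forall>i\<in>{1..K}. (\<integral>\<^sup>+ w. ennreal \<bar>real_of_int (eps p n i w)\<bar> \<partial>mun \<alpha> \<beta> \<gamma> n) < ennreal C) \<and>
           (\<forall>j\<in>{1..L}. (\<integral>\<^sup>+ w. ennreal \<bar>real_of_int (eps' p n j w)\<bar> \<partial>mun \<alpha> \<beta> \<gamma> n) < ennreal C)"
proof -
  have p: "linear_order_on Alph p" "monotone_on_G p"
    using assms(9) by (auto simp: admissible_def monotone_on_G_def)
  \<comment> \<open>At \<open>k = K\<close> the strict decrease follows from strict monotonicity, as
    \<alpha> is positive there.\<close>
  have \<alpha>: "\<alpha> (Suc k) < \<alpha> k" if "1 \<le> k" "k \<le> K" for k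
    using assms(2,5,6) that by (cases "k = K") (auto simp: strictly_monotone_params_def)
  have \<beta>: "\<beta> (Suc k) < \<beta> k" if "1 \<le> k" "k \<le> L" for k
    using assms(2,7,8) that by (cases "k = L") (auto simp: strictly_monotone_params_def)
  obtain C1 where C1: "\<And>n k. k \<in> {1..K} \<Longrightarrow> (\<integral>\<^sup>+ w. ennreal \<bar>real_of_int (eps p n k w)\<bar> \<partial>mun \<alpha> \<beta> \<gamma> n) < ennreal C1"
    using nn_integral_abs_of_partial_sums[OF sum_eps_bounds[OF assms(1) p _ \<alpha>]] by blast
  obtain C2 where C2: "\<And>n k. k \<in> {1..L} \<Longrightarrow> (\<integral>\<^sup>+ w. ennreal \<bar>real_of_int (eps' p n k w)\<bar> \<partial>mun \<alpha> \<beta> \<gamma> n) < ennreal C2"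
    using nn_integral_abs_of_partial_sums[OF sum_eps'_bounds[OF assms(1) p _ \<beta>]] by blast
  have "ennreal C1 \<le> ennreal (max C1 C2)" "ennreal C2 \<le> ennreal (max C1 C2)"
    by (intro ennreal_leI; simp)+
  then show ?thesis
    using C1 C2 by (intro exI[of _ "max C1 C2"]) (meson order.strict_trans2)
qed

end
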